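(* Let $\Phi\subseteq V^*$ be an essential irreducible root system of classical type ($\mathrm A_n$, $\mathrm B_n$, $\mathrm C_n$ or $\mathrm D_n$), and let $\mathcal V\subseteq V$ be the vertex set of the Euclidean Coxeter complex $\Sigma$ of type $\Phi$. For every L-convex function $f:\mathcal V\to\mathbb R\cup\{+\infty\}$ of type $\Phi$, one has $\overline f=\operatorname{conv} f=\overline{\operatorname{conv}} f$ (the Lovász extension, the convex hull and the closed convex hull of $f$ coincide), and this common function is the unique primal-integral locally polyhedral L-convex function $V\to\mathbb R\cup\{+\infty\}$ of type $\Phi$ whose restriction to $\mathcal V$ is $f$.
   Context: Root systems. $V$ is a finite-dimensional real inner product space with dual $V^*$, $\langle p,x\rangle=p(x)$ for $p\in V^*,x\in V$; $V^*$ carries the induced inner product. For $\alpha\in V^*\setminus\{0\}$, $\alpha^\vee\in V$ is $2/\|\alpha\|^2$ times the vector of $V$ representing $\alpha$, and $s_\alpha(p)=p-\langle p,\alpha^\vee\rangle\alpha$. A root system is a nonempty finite set $\Phi\subseteq V^*\setminus\{0\}$ with $s_\alpha(\beta)\in\Phi$, $\mathbb R\alpha\cap\Phi=\{\alpha,-\alpha\}$ and $\langle\alpha,\beta^\vee\rangle\in\mathbb Z$ for all $\alpha,\beta\in\Phi$. It is essential if $\operatorname{span}\Phi=V^*$, and irreducible if it is not a disjoint union of two nonempty mutually orthogonal subsets. Euclidean Coxeter complex. For $(\alpha,k)\in\Phi\times\mathbb Z$ let $H^0_{\alpha,k},H^+_{\alpha,k},H^-_{\alpha,k}$ be the sets of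 $x\in V$ with $\langle\alpha,x\rangle=k$, $>k$, $<k$. An (open) cell is a nonempty set $\bigcap_{(\alpha,k)\in\Phi\times\mathbb Z}H^{\sigma_{\alpha,k}}_{\alpha,k}$ with $\sigma_{\alpha,k}\in\{+,0,-\}$. $\Sigma$ is the set of all cells together with $\emptyset$, ordered by $A\preceq B\iff\operatorname{cl}A\subseteq\operatorname{cl}B$; it is a simplicial complex, the cells partition $V$, and each nonempty cell $A$ is the relative interior of a geometric simplex, whose vertex set is denoted $\mathcal V(A)$. $\mathcal V$ is the set of vertices (one-point cells, identified with points of $V$). For $x\in V$, $A_x$ is the cell containing $x$ and $\lambda_x$ the unique convex-combination coefficients with support $\mathcal V(A_x)$ such that $x=\sum_v\lambda_x(v)v$. The Lovász extension of $f:\mathcal V\to\mathbb R\cup\{+\infty\}$ is $\overline f(x)=\sum_{v\in\mathcal V(A_x)}\lambda_x(v)f(v)$, $x\in V$. Hulls. A function on $\mathcal V$ is regarded as a function on $V$ with value $+\infty$ off $\mathcal V$; $\operatorname{dom} f$ is the set where $f$ is finite. $(\operatorname{conv} f)(x)=\inf\sum_y\lambda(y)f(y)$ over finitely supported convex coefficients $\lambda$ on $\operatorname{dom} f$ with $\sum_y\lambda(y)y=x$; $(\overline{\operatorname{conv}} f)(x)=\sup\{\langle p,x\rangle-r: p\in V^*,r\in\mathbb R,\ \langle p,y\rangle-r\le f(y)\ \forall y\in\operatorname{dom} f\}$. Convexity notions. A convex set is locally polyhedral if its intersection with every polytope is a polytope; a function is locally polyhedral convex if its epigraph is a locally polyhedral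 convex set. For a function $h$ on $V$, $\Pi(h)=\{\operatorname{argmin}(h-p): p\in V^*,\ \operatorname{argmin}(h-p)\ne\emptyset\}$, where $(h-p)(x)=h(x)-\langle p,x\rangle$. An integral L-convex polyhedron of type $\Phi$ is a nonempty set $\{x\in V:\langle\alpha,x\rangle\le\gamma(\alpha)\ \forall\alpha\in\Phi\}$ with $\gamma:\Phi\to\mathbb Z\cup\{+\infty\}$. A primal-integral locally polyhedral L-convex function of type $\Phi$ is a proper locally polyhedral convex function $\hat f:V\to\mathbb R\cup\{+\infty\}$ such that every member of $\Pi(\hat f)$ is an integral L-convex polyhedron of type $\Phi$. A function $f:\mathcal V\to\mathbb R\cup\{+\infty\}$ is L-convex of type $\Phi$ if it is the restriction to $\mathcal V$ of some such $\hat f$. *)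

theory Defs
  imports "HOL-Analysis.Analysis"
begin

text \<open>
  The space \<open>V\<close> is a type of class \<open>euclidean_space\<close>. Its dual is the type of bounded linear
  functionals (every linear functional on \<open>V\<close> is bounded), so the pairing of \<open>p\<close> and \<open>x\<close>
  is the application \<open>p x\<close>.
\<close>

type_synonym 'a dual = "'a \<Rightarrow>\<^sub>L real"

section \<open>Root systems\<close>

definition riesz :: "'a::euclidean_space dual \<Rightarrow> 'a" where
  "riesz p = (THE v. \<forall>x. p x = v \<bullet> x)"

lemma riesz_inner: "p x = riesz p \<bullet> x" for p :: "'a::euclidean_space dual"
proof -
  have "p x = (\<Sum>b\<in>Basis. p b *\<^sub>R b) \<bullet> x" for x
  proof -
    have "p x = p (\<Sum>b\<in>Basis. (x \<bullet> b) *\<^sub>R b)"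
      by (simp only: euclidean_representation)
    also have "\<dots> = (\<Sum>b\<in>Basis. (x \<bullet> b) * p b)"
      by (simp add: blinfun.sum_right blinfun.scaleR_right)
    finally show ?thesis
      by (simp add: inner_sum_left inner_commute[of x] mult.commute)
  qed
  then have "\<exists>!v. \<forall>x. p x = v \<bullet> x"
    by (metis vector_eq_rdot)
  from theI'[OF this] show ?thesis
    unfolding riesz_def by blast
qed

definition dual_inner :: "'a::euclidean_space dual \<Rightarrow> 'a dual \<Rightarrow> real" where
  "dual_inner p q = riesz p \<bullet> riesz q"

definition coroot :: "'a::euclidean_space dual \<Rightarrow> 'a" where
  "coroot \<alpha> = (2 / dual_inner \<alpha> \<alpha>) *\<^sub>R riesz \<alpha>"

definition root_reflection :: "'a::euclidean_space dual \<Rightarrow> 'a dual \<Rightarrow> 'a dual" where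
  "root_reflection \<alpha> p = p - p (coroot \<alpha>) *\<^sub>R \<alpha>"

definition root_system :: "'a::euclidean_space dual set \<Rightarrow> bool" where
  "root_system \<Phi> \<longleftrightarrow>
     finite \<Phi> \<and> \<Phi> \<noteq> {} \<and> 0 \<notin> \<Phi> \<and>
     (\<forall>\<alpha>\<in>\<Phi>. \<forall>\<beta>\<in>\<Phi>. root_reflection \<alpha> \<beta> \<in> \<Phi>) \<and>
     (\<forall>\<alpha>\<in>\<Phi>. range (\<lambda>c. c *\<^sub>R \<alpha>) \<inter> \<Phi> = {\<alpha>, - \<alpha>}) \<and>
     (\<forall>\<alpha>\<in>\<Phi>. \<forall>\<beta>\<in>\<Phi>. \<alpha> (coroot \<beta>) \<in> \<int>)"

definition essential :: "'a::euclidean_space dual set \<Rightarrow> bool" where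
  "essential \<Phi> \<longleftrightarrow> span \<Phi> = UNIV"

definition irreducible_roots :: "'a::euclidean_space dual set \<Rightarrow> bool" where
  "irreducible_roots \<Phi> \<longleftrightarrow>
     \<not> (\<exists>\<Phi>1 \<Phi>2. \<Phi>1 \<noteq> {} \<and> \<Phi>2 \<noteq> {} \<and> \<Phi>1 \<inter> \<Phi>2 = {} \<and> \<Phi>1 \<union> \<Phi>2 = \<Phi> \<and>
              (\<forall>\<alpha>\<in>\<Phi>1. \<forall>\<beta>\<in>\<Phi>2. dual_inner \<alpha> \<beta> = 0))"

text \<open>
  The standard models of the classical root systems. Vectors of \<open>\<real>\<^sup>m\<close> are functions on \<open>nat\<close>
  supported on \<open>{..<m}\<close>, with \<open>m = n\<close> for the types B, C, D of rank \<open>n\<close> and \<open>m = n + 1\<close> for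
  type A of rank \<open>n\<close>, whose model spans the hyperplane of coordinate sum zero.
\<close>

definition unit_vec :: "nat \<Rightarrow> nat \<Rightarrow> real" where
  "unit_vec i = (\<lambda>k. if k = i then 1 else 0)"

definition model_A :: "nat \<Rightarrow> (nat \<Rightarrow> real) set" where
  "model_A n = {\<lambda>k. unit_vec i k - unit_vec j k | i j. i \<le> n \<and> j \<le> n \<and> i \<noteq> j}"

definition model_D :: "nat \<Rightarrow> (nat \<Rightarrow> real) set" where
  "model_D n = {\<lambda>k. s * unit_vec i k + t * unit_vec j k | i j s t.
                  i < j \<and> j < n \<and> s \<in> {1, -1} \<and> t \<in> {1, -1}}"

definition model_B :: "nat \<Rightarrow> (nat \<Rightarrow> real) set" where
  "model_B n = {\<lambda>k. s * unit_vec i k | i s. i < n \<and> s \<in> {1, -1}} \<union> model_D n"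

definition model_C :: "nat \<Rightarrow> (nat \<Rightarrow> real) set" where
  "model_C n = {\<lambda>k. 2 * s * unit_vec i k | i s. i < n \<and> s \<in> {1, -1}} \<union> model_D n"

definition model_inner :: "nat \<Rightarrow> (nat \<Rightarrow> real) \<Rightarrow> (nat \<Rightarrow> real) \<Rightarrow> real" where
  "model_inner m u v = (\<Sum>i<m. u i * v i)"

text \<open>
  Isomorphism of root systems with a model \<open>M\<close> in \<open>\<real>\<^sup>m\<close>: a linear map \<open>T\<close> on \<open>\<real>\<^sup>m\<close>, given by the
  images \<open>e i\<close> of the unit vectors, that maps \<open>M\<close> bijectively onto \<open>\<Phi>\<close> and preserves the Cartan
  integers. Such a \<open>T\<close> is injective on the span of \<open>M\<close>: if \<open>T u = 0\<close> with \<open>u\<close> in the span, then \<open>u\<close> is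
  orthogonal to \<open>M\<close>. Conversely, a linear map on the span of \<open>M\<close> extends to \<open>\<real>\<^sup>m\<close>.
\<close>

definition root_iso_model :: "nat \<Rightarrow> (nat \<Rightarrow> real) set \<Rightarrow> 'a::euclidean_space dual set \<Rightarrow> bool" where
  "root_iso_model m M \<Phi> \<longleftrightarrow>
     (\<exists>(e :: nat \<Rightarrow> 'a dual) T.
        (\<forall>u. T u = (\<Sum>i<m. u i *\<^sub>R e i)) \<and>
        bij_betw T M \<Phi> \<and>
        (\<forall>u\<in>M. \<forall>v\<in>M. (T u) (coroot (T v)) = 2 * model_inner m u v / model_inner m v v))"

definition classical_type :: "'a::euclidean_space dual set \<Rightarrow> bool" where
  "classical_type \<Phi> \<longleftrightarrow>
     (\<exists>n\<ge>1. root_iso_model (n + 1) (model_A n) \<Phi>) \<or>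
     (\<exists>n\<ge>2. root_iso_model n (model_B n) \<Phi>) \<or>
     (\<exists>n\<ge>2. root_iso_model n (model_C n) \<Phi>) \<or>
     (\<exists>n\<ge>4. root_iso_model n (model_D n) \<Phi>)"

section \<open>The Euclidean Coxeter complex\<close>

datatype sign = Pos | Zero | Neg

fun half_or_hyperplane :: "sign \<Rightarrow> 'a::euclidean_space dual \<Rightarrow> int \<Rightarrow> 'a set" where
  "half_or_hyperplane Zero \<alpha> k = {x. \<alpha> x = of_int k}"
| "half_or_hyperplane Pos \<alpha> k = {x. \<alpha> x > of_int k}"
| "half_or_hyperplane Neg \<alpha> k = {x. \<alpha> x < of_int k}"

definition cells :: "'a::euclidean_space dual set \<Rightarrow> 'a set set" where
  "cells \<Phi> = {C. C \<noteq> {} \<and>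
     (\<exists>\<sigma> :: 'a dual \<Rightarrow> int \<Rightarrow> sign.
        C = (\<Inter>(\<alpha>, k) \<in> \<Phi> \<times> UNIV. half_or_hyperplane (\<sigma> \<alpha> k) \<alpha> k))}"

definition vertices :: "'a::euclidean_space dual set \<Rightarrow> 'a set" where
  "vertices \<Phi> = {v. {v} \<in> cells \<Phi>}"

text \<open>The vertex set of the geometric simplex whose relative interior is the given cell.\<close>

definition cell_vertices :: "'a::euclidean_space set \<Rightarrow> 'a set" where
  "cell_vertices A = (THE S. \<not> affine_dependent S \<and> A = rel_interior (convex hull S))"

definition cell_of :: "'a::euclidean_space dual set \<Rightarrow> 'a \<Rightarrow> 'a set" where
  "cell_of \<Phi> x = (THE C. C \<in> cells \<Phi> \<and> x \<in> C)"

definition bary_coeffs :: "'a::euclidean_space dual set \<Rightarrow> 'a \<Rightarrow> 'a \<Rightarrow> real" where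
  "bary_coeffs \<Phi> x = (THE c.
     {v. c v \<noteq> 0} = cell_vertices (cell_of \<Phi> x) \<and> (\<forall>v. c v \<ge> 0) \<and>
     (\<Sum>v\<in>cell_vertices (cell_of \<Phi> x). c v) = 1 \<and>
     (\<Sum>v\<in>cell_vertices (cell_of \<Phi> x). c v *\<^sub>R v) = x)"

text \<open>
  A function \<open>\<V> \<rightarrow> \<real> \<union> {+\<infinity>}\<close> on the vertex set is encoded as a function on \<open>V\<close> with value
  \<open>+\<infinity>\<close> off the vertices.
\<close>

definition vertex_function :: "'a::euclidean_space dual set \<Rightarrow> ('a \<Rightarrow> ereal) \<Rightarrow> bool" where
  "vertex_function \<Phi> f \<longleftrightarrow> (\<forall>v\<in>vertices \<Phi>. f v \<noteq> -\<infinity>) \<and> (\<forall>x. x \<notin> vertices \<Phi> \<longrightarrow> f x = \<infinity>)"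

definition lovasz :: "'a::euclidean_space dual set \<Rightarrow> ('a \<Rightarrow> ereal) \<Rightarrow> 'a \<Rightarrow> ereal" where
  "lovasz \<Phi> f x = (\<Sum>v\<in>cell_vertices (cell_of \<Phi> x). ereal (bary_coeffs \<Phi> x v) * f v)"

section \<open>Hulls\<close>

definition fdom :: "('a \<Rightarrow> ereal) \<Rightarrow> 'a set" where
  "fdom f = {x. \<bar>f x\<bar> \<noteq> \<infinity>}"

definition conv_fun :: "('a::euclidean_space \<Rightarrow> ereal) \<Rightarrow> 'a \<Rightarrow> ereal" where
  "conv_fun f x = Inf {(\<Sum>y\<in>S. ereal (c y) * f y) | S c.
     finite S \<and> S \<subseteq> fdom f \<and> (\<forall>y\<in>S. c y \<ge> 0) \<and> sum c S = 1 \<and> (\<Sum>y\<in>S. c y *\<^sub>R y) = x}"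

definition closed_conv_fun :: "('a::euclidean_space \<Rightarrow> ereal) \<Rightarrow> 'a \<Rightarrow> ereal" where
  "closed_conv_fun f x = Sup {ereal (p x - r) | (p :: 'a dual) r.
     \<forall>y\<in>fdom f. ereal (p y - r) \<le> f y}"

section \<open>Convexity notions\<close>

definition locally_polyhedral :: "'a::euclidean_space set \<Rightarrow> bool" where
  "locally_polyhedral S \<longleftrightarrow> convex S \<and> (\<forall>P. polytope P \<longrightarrow> polytope (S \<inter> P))"

definition epi :: "('a \<Rightarrow> ereal) \<Rightarrow> ('a \<times> real) set" where
  "epi h = {(x, t). h x \<le> ereal t}"

definition locally_polyhedral_fun :: "('a::euclidean_space \<Rightarrow> ereal) \<Rightarrow> bool" where
  "locally_polyhedral_fun h \<longleftrightarrow> locally_polyhedral (epi h)"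

definition proper_fun :: "('a \<Rightarrow> ereal) \<Rightarrow> bool" where
  "proper_fun h \<longleftrightarrow> (\<forall>x. h x \<noteq> -\<infinity>) \<and> (\<exists>x. h x \<noteq> \<infinity>)"

definition argmin_set :: "('a \<Rightarrow> ereal) \<Rightarrow> 'a set" where
  "argmin_set h = {x. \<forall>y. h x \<le> h y}"

definition min_faces :: "('a::euclidean_space \<Rightarrow> ereal) \<Rightarrow> 'a set set" where
  "min_faces h = {argmin_set (\<lambda>x. h x - ereal (p x)) | p :: 'a dual.
                    argmin_set (\<lambda>x. h x - ereal (p x)) \<noteq> {}}"

definition integral_L_polyhedron :: "'a::euclidean_space dual set \<Rightarrow> 'a set \<Rightarrow> bool" where
  "integral_L_polyhedron \<Phi> P \<longleftrightarrow> P \<noteq> {} \<and>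
     (\<exists>\<gamma> :: 'a dual \<Rightarrow> ereal.
        (\<forall>\<alpha>\<in>\<Phi>. \<gamma> \<alpha> = \<infinity> \<or> (\<exists>k::int. \<gamma> \<alpha> = ereal (of_int k))) \<and>
        P = {x. \<forall>\<alpha>\<in>\<Phi>. ereal (blinfun_apply \<alpha> x) \<le> \<gamma> \<alpha>})"

definition primal_integral_L_convex ::
    "'a::euclidean_space dual set \<Rightarrow> ('a \<Rightarrow> ereal) \<Rightarrow> bool" where
  "primal_integral_L_convex \<Phi> h \<longleftrightarrow>
     proper_fun h \<and> locally_polyhedral_fun h \<and> (\<forall>P\<in>min_faces h. integral_L_polyhedron \<Phi> P)"

definition L_convex :: "'a::euclidean_space dual set \<Rightarrow> ('a \<Rightarrow> ereal) \<Rightarrow> bool" where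
  "L_convex \<Phi> f \<longleftrightarrow> vertex_function \<Phi> f \<and>
     (\<exists>h. primal_integral_L_convex \<Phi> h \<and> (\<forall>v\<in>vertices \<Phi>. f v = h v))"

end

theory Submission
  imports Defs
begin

text \<open>
  Everything rests on one identity: if \<open>h\<close> is a primal-integral locally polyhedral L-convex function
  that agrees with \<open>f\<close> on the vertices, then the Lovasz extension of \<open>f\<close> is \<open>h\<close>
  (\<open>L_convex_eq_lovasz\<close>). Let \<open>h x < \<infinity>\<close>. Since the epigraph is polyhedral near \<open>(x, h x)\<close>, there is a
  subgradient \<open>p\<close> at \<open>x\<close> (\<open>subgradient_exists\<close>), so \<open>x\<close> lies in the face \<open>P = argmin (h - p)\<close>. This face is
  described by inequalities \<open>\<alpha> y \<le> k\<close> with \<open>\<alpha>\<close> a root and \<open>k\<close> an integer, so it contains the closure of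
  the cell of \<open>x\<close>, in particular its vertices. As \<open>h\<close> is affine on \<open>P\<close>, its value at \<open>x\<close> is the
  barycentric combination of its values at these vertices. Existence and uniqueness of the
  extension follow at once. The convex hull of \<open>f\<close> is at most the Lovasz extension by definition
  and at least \<open>h\<close> by convexity; the closed convex hull equals \<open>h\<close> because affine minorants of \<open>h\<close> are
  affine minorants of \<open>f\<close>, and those of \<open>h\<close> attain \<open>h x\<close> or, where \<open>h x = \<infinity>\<close>, are unbounded
  (\<open>affine_minorant_above\<close>).

  The Lovasz extension is meaningful only because the cells are open simplices whose vertices are
  one-point cells (\<open>coxeter_cell\<close>). This holds for all essential irreducible root systems. The outer
  normals of the walls of an alcove form pairwise non-acute angles (\<open>obtuse\<close>), and the walls bound a
  compact set. A nonnegative linear dependency among the normals splits the walls into two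
  orthogonal families, its support and the rest; such a splitting extends to all roots
  (\<open>root_in_wall_component\<close>), so irreducibility makes the support everything. Hence the dependency is
  unique up to scaling and has coefficients of one sign, which says that the closed alcove is a
  simplex (\<open>alcove_barycentric\<close>). An arbitrary cell lies in the closure of an alcove and is the
  relative interior of one of its faces (\<open>cell_is_open_simplex\<close>).
\<close>

section \<open>Subgradients of locally polyhedral convex functions\<close>

lemma locally_polyhedral_closed:
  fixes S :: "'a::euclidean_space set"
  assumes "locally_polyhedral S"
  shows "closed S"
  unfolding closed_sequential_limits
proof (intro allI impI, elim conjE)
  fix f :: "nat \<Rightarrow> 'a" and l
  assume f: "\<forall>n. f n \<in> S" and lim: "f \<longlonglongrightarrow> l"
  let ?B = "cbox (l - One) (l + One)"
  have "polytope (S \<inter> ?B)"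
    using assms polytope_interval unfolding locally_polyhedral_def by blast
  then have closed: "closed (S \<inter> ?B)"
    by (rule polytope_imp_closed)
  have "l \<in> box (l - One) (l + One)"
    by (simp add: mem_box inner_diff_left inner_add_left)
  then have "\<forall>\<^sub>F n in sequentially. f n \<in> box (l - One) (l + One)"
    using lim open_box topological_tendstoD by blast
  then have "\<forall>\<^sub>F n in sequentially. f n \<in> S \<inter> ?B"
    by eventually_elim (use f box_subset_cbox in blast)
  from Lim_in_closed_set[OF closed this _ lim] show "l \<in> S"
    by simp
qed

lemma small_step_in_open:
  fixes e d :: "'a::real_normed_vector"
  assumes "open U" "e \<in> U"
  shows "\<exists>\<epsilon>>0. \<forall>t. 0 < t \<and> t < \<epsilon> \<longrightarrow> e + t *\<^sub>R d \<in> U"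
proof -
  have "((\<lambda>t. e + t *\<^sub>R d) \<longlongrightarrow> e + 0 *\<^sub>R d) (at_right 0)"
    by (intro tendsto_intros)
  then have "\<forall>\<^sub>F t in at_right 0. e + t *\<^sub>R d \<in> U"
    using assms topological_tendstoD by force
  then show ?thesis
    by (auto simp: eventually_at_right_field)
qed

text \<open>
  If a direction leaves a locally polyhedral set immediately, a halfspace containing the whole set
  already forbids that direction: it is one of the finitely many halfspaces that cut out the set
  near the point, and convexity makes this local constraint a global one.
\<close>

lemma locally_polyhedral_blocking_halfspace:
  fixes E :: "'a::euclidean_space set"
  assumes E: "locally_polyhedral E" and e: "e \<in> E"
    and out: "\<And>t. 0 < t \<Longrightarrow> e + t *\<^sub>R d \<notin> E"
  shows "\<exists>a. 0 < a \<bullet> d \<and> (\<forall>z\<in>E. a \<bullet> z \<le> a \<bullet> e)"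
proof -
  let ?U = "box (e - One) (e + One)" and ?B = "cbox (e - One) (e + One)"
  have eU: "e \<in> ?U"
    by (simp add: mem_box inner_diff_left inner_add_left)
  have UB: "?U \<subseteq> ?B"
    by (rule box_subset_cbox)
  have "polytope (E \<inter> ?B)"
    using E polytope_interval unfolding locally_polyhedral_def by blast
  then have "polyhedron (E \<inter> ?B)"
    by (rule polytope_imp_polyhedron)
  then obtain F where F: "finite F" "E \<inter> ?B = \<Inter>F"
    "\<forall>h\<in>F. \<exists>a b. a \<noteq> 0 \<and> h = {x. a \<bullet> x \<le> b}"
    unfolding polyhedron_def by auto
  obtain a b where ab: "\<And>h. h \<in> F \<Longrightarrow> h = {x. a h \<bullet> x \<le> b h}"
    using F(3) by metis
  \<comment> \<open>If no active constraint opposed \<open>d\<close>, a short step along \<open>d\<close> would stay in \<open>E\<close>.\<close>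
  have active: "\<exists>h\<in>F. a h \<bullet> e = b h \<and> 0 < a h \<bullet> d"
  proof (rule ccontr)
    assume no: "\<not> ?thesis"
    have "\<forall>\<^sub>F t in at_right 0. a h \<bullet> (e + t *\<^sub>R d) \<le> b h" if h: "h \<in> F" for h
    proof -
      have le: "a h \<bullet> e \<le> b h"
        using F(2) ab[OF h] e eU UB h by blast
      show ?thesis
      proof (cases "a h \<bullet> e = b h")
        case True
        then have "a h \<bullet> d \<le> 0"
          using no h by force
        then show ?thesis
          using True eventually_at_right_less[of 0]
          by (auto elim!: eventually_mono simp: inner_add_right mult_nonneg_nonpos)
      next
        case False
        have "((\<lambda>t. a h \<bullet> (e + t *\<^sub>R d)) \<longlongrightarrow> a h \<bullet> (e + 0 *\<^sub>R d)) (at_right 0)"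
          by (intro tendsto_intros)
        then have "\<forall>\<^sub>F t in at_right 0. a h \<bullet> (e + t *\<^sub>R d) < b h"
          using False le by (intro order_tendstoD(2)) auto
        then show ?thesis
          by eventually_elim simp
      qed
    qed
    then have "\<forall>\<^sub>F t in at_right 0. \<forall>h\<in>F. a h \<bullet> (e + t *\<^sub>R d) \<le> b h"
      using F(1) by (simp add: eventually_ball_finite_distrib)
    moreover have "\<forall>\<^sub>F t::real in at_right 0. 0 < t"
      by (rule eventually_at_right_less)
    ultimately have "\<forall>\<^sub>F t::real in at_right 0. False"
    proof eventually_elim
      case (elim t)
      then have "e + t *\<^sub>R d \<in> \<Inter>F"
        using ab by blast
      then show False
        using out elim(2) F(2) by blast
    qed
    then show False
      by simp
  qed
  then obtain h where h: "h \<in> F" "a h \<bullet> e = b h" "0 < a h \<bullet> d"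
    by blast
  have "a h \<bullet> z \<le> a h \<bullet> e" if z: "z \<in> E" for z
  proof -
    obtain \<epsilon> where eps: "\<epsilon> > 0" "\<And>t. 0 < t \<and> t < \<epsilon> \<Longrightarrow> e + t *\<^sub>R (z - e) \<in> ?U"
      using small_step_in_open[OF open_box eU] by blast
    define t where "t = min (\<epsilon>/2) (1/2)"
    have t: "0 < t" "t < \<epsilon>" "t \<le> 1"
      using eps(1) by (auto simp: t_def)
    have "(1 - t) *\<^sub>R e + t *\<^sub>R z \<in> E"
      using E e z t unfolding locally_polyhedral_def by (intro convexD) auto
    then have "e + t *\<^sub>R (z - e) \<in> E"
      by (simp add: algebra_simps)
    then have "e + t *\<^sub>R (z - e) \<in> h"
      using eps(2)[of t] t UB F(2) h(1) by blast
    then have "a h \<bullet> (e + t *\<^sub>R (z - e)) \<le> b h"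
      using ab[OF h(1)] by blast
    then have "t * (a h \<bullet> (z - e)) \<le> 0"
      using h(2) by (simp add: inner_add_right)
    then show ?thesis
      using t(1) by (simp add: mult_le_0_iff inner_diff_right)
  qed
  then show ?thesis
    using h(3) by blast
qed

lemma real_of_proper:
  assumes "proper_fun h" "h x \<noteq> \<infinity>"
  shows "ereal (real_of_ereal (h x)) = h x"
  using assms unfolding proper_fun_def by (metis ereal_real' ereal_infinity_cases)

lemma linear_functional_ex: "\<exists>p :: 'a::euclidean_space dual. \<forall>x. p x = q \<bullet> x"
  by (rule exI[of _ "Blinfun (inner q)"])
    (simp add: bounded_linear_Blinfun_apply bounded_linear_inner_right)

text \<open>
  The direction blocked is the downward vertical one, so the normal of the halfspace has a nonzero
  vertical component and yields a subgradient.
\<close>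

lemma subgradient_exists:
  fixes h :: "'a::euclidean_space \<Rightarrow> ereal"
  assumes hp: "proper_fun h" and lp: "locally_polyhedral_fun h" and x: "h x \<noteq> \<infinity>"
  shows "\<exists>p :: 'a dual. x \<in> argmin_set (\<lambda>y. h y - ereal (p y))"
proof -
  define m where "m = real_of_ereal (h x)"
  have hx: "h x = ereal m"
    using real_of_proper[OF hp x] by (simp add: m_def)
  have "(x, m) \<in> epi h"
    by (simp add: epi_def hx)
  moreover have "(x, m) + t *\<^sub>R (0, -1) \<notin> epi h" if "0 < t" for t
    using that by (simp add: epi_def hx)
  ultimately obtain a where a: "0 < a \<bullet> (0, -1)" "\<forall>z\<in>epi h. a \<bullet> z \<le> a \<bullet> (x, m)"
    using locally_polyhedral_blocking_halfspace[of "epi h" "(x, m)" "(0, -1)"] lp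
    unfolding locally_polyhedral_fun_def by blast
  obtain q s where qs: "a = (q, s)"
    by fastforce
  have s: "s < 0"
    using a(1) qs by simp
  obtain p :: "'a dual" where p: "\<And>y. p y = (q /\<^sub>R (-s)) \<bullet> y"
    using linear_functional_ex by blast
  have "h x - ereal (p x) \<le> h y - ereal (p y)" for y
  proof (cases "h y = \<infinity>")
    case True
    then show ?thesis by simp
  next
    case False
    then obtain k where k: "h y = ereal k"
      using real_of_proper[OF hp] by metis
    then have "(y, k) \<in> epi h"
      by (simp add: epi_def)
    then have "q \<bullet> y + s * k \<le> q \<bullet> x + s * m"
      using a(2) qs by auto
    then have "(q \<bullet> x + s * m) / s \<le> (q \<bullet> y + s * k) / s"
      using s by (intro divide_right_mono_neg) auto
    moreover have "(q \<bullet> z + s * j) / s = j - p z" for z j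
      using s by (simp add: p field_simps)
    ultimately have "m - p x \<le> k - p y"
      by simp
    then show ?thesis
      by (simp add: hx k)
  qed
  then show ?thesis
    by (auto simp: argmin_set_def)
qed

text \<open>
  Outside the effective domain the affine minorants are unbounded: this is the part of the
  Fenchel-Moreau theorem that subgradients do not give.
\<close>

lemma affine_minorant_above:
  fixes h :: "'a::euclidean_space \<Rightarrow> ereal"
  assumes hp: "proper_fun h" and lp: "locally_polyhedral_fun h" and x: "h x = \<infinity>"
  shows "\<exists>(p :: 'a dual) r. (\<forall>y. ereal (p y - r) \<le> h y) \<and> M < p x - r"
proof -
  obtain x1 where x1: "h x1 \<noteq> \<infinity>"
    using hp by (auto simp: proper_fun_def)
  define m1 where "m1 = real_of_ereal (h x1)"
  have hx1: "h x1 = ereal m1"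
    using real_of_proper[OF hp x1] by (simp add: m1_def)
  obtain p1 :: "'a dual" where p1: "x1 \<in> argmin_set (\<lambda>y. h y - ereal (p1 y))"
    using subgradient_exists[OF hp lp x1] by blast
  have min1: "p1 y - (p1 x1 - m1) \<le> k" if "h y = ereal k" for y k
    using p1 hx1 that by (auto simp: argmin_set_def dest: spec[of _ y])
  have "closed (epi h)" "convex (epi h)"
    using lp locally_polyhedral_closed by (auto simp: locally_polyhedral_fun_def locally_polyhedral_def)
  moreover have "(x, M) \<notin> epi h"
    using x by (simp add: epi_def)
  ultimately obtain a b where ab: "a \<bullet> (x, M) < b" "\<forall>z\<in>epi h. a \<bullet> z > b"
    using separating_hyperplane_closed_point by metis
  obtain q s where qs: "a = (q, s)"
    by fastforce
  have sep: "q \<bullet> y + s * t > b" if "h y \<le> ereal t" for y t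
    using ab(2) qs that by (auto simp: epi_def)
  have sepx: "q \<bullet> x + s * M < b"
    using ab(1) qs by simp
  have s0: "s \<ge> 0"
  proof (rule ccontr)
    assume "\<not> s \<ge> 0"
    then have s: "s < 0" by simp
    define t where "t = max m1 ((b - q \<bullet> x1) / s)"
    have "s * t \<le> s * ((b - q \<bullet> x1) / s)"
      using s by (intro mult_left_mono_neg) (auto simp: t_def)
    then have "q \<bullet> x1 + s * t \<le> b"
      using s by simp
    then show False
      using sep[of x1 t] hx1 by (simp add: t_def)
  qed
  show ?thesis
  proof (cases "s = 0")
    case False
    then have s: "s > 0" using s0 by simp
    obtain p :: "'a dual" where p: "\<And>y. p y = (- q /\<^sub>R s) \<bullet> y"
      using linear_functional_ex by blast
    have "ereal (p y - (- b / s)) \<le> h y" for y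
    proof (cases "h y = \<infinity>")
      case False
      then obtain k where k: "h y = ereal k"
        using real_of_proper[OF hp] by metis
      then have "q \<bullet> y + s * k > b"
        using sep by simp
      then show ?thesis
        using s by (simp add: k p field_simps)
    qed simp
    moreover have "M < p x - (- b / s)"
      using sepx s by (simp add: p field_simps)
    ultimately show ?thesis by blast
  next
    case True
    \<comment> \<open>The separating hyperplane is vertical: add a large multiple of it to some affine minorant.\<close>
    define g where "g = b - q \<bullet> x"
    have g: "g > 0"
      using sepx True by (simp add: g_def)
    define l where "l = max 0 ((M - p1 x + (p1 x1 - m1)) / g + 1)"
    have l: "l \<ge> 0" "l > (M - p1 x + (p1 x1 - m1)) / g"
      by (auto simp: l_def)
    obtain p :: "'a dual" where p: "\<And>y. p y = (riesz p1 - l *\<^sub>R q) \<bullet> y"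
      using linear_functional_ex by blast
    define r where "r = (p1 x1 - m1) - l * b"
    have pr: "p y - r = p1 y - (p1 x1 - m1) + l * (b - q \<bullet> y)" for y
      by (simp add: p r_def inner_diff_left riesz_inner[of p1] algebra_simps)
    have "ereal (p y - r) \<le> h y" for y
    proof (cases "h y = \<infinity>")
      case False
      then obtain k where k: "h y = ereal k"
        using real_of_proper[OF hp] by metis
      then have "q \<bullet> y > b"
        using sep[of y k] True by simp
      then have "l * (b - q \<bullet> y) \<le> 0"
        using l by (simp add: mult_nonneg_nonpos)
      then show ?thesis
        using min1[OF k] by (simp add: k pr)
    qed simp
    moreover have "M < p x - r"
      using l(2) g by (simp add: pr g_def[symmetric] field_simps)
    ultimately show ?thesis by blast
  qed
qed

section \<open>Alcoves and their walls\<close>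

lemma orthogonal_spans:
  fixes u :: "'a::euclidean_space"
  assumes orth: "\<And>a b. \<lbrakk>a \<in> A; b \<in> B\<rbrakk> \<Longrightarrow> a \<bullet> b = 0"
    and u: "u \<in> span A" and v: "v \<in> span B"
  shows "u \<bullet> v = 0"
proof -
  have "orthogonal u b" if "b \<in> B" for b
    using u orth that orthogonal_to_span[of u A b] by (auto simp: orthogonal_def inner_commute)
  then show ?thesis
    using orthogonal_to_span[OF v, of u] by (auto simp: orthogonal_def)
qed

text \<open>
  An essential irreducible root system, represented by vectors of \<open>V\<close> through the inner product;
  the constant \<open>riesz\<close> gives the passage from functionals to vectors.
\<close>

locale root_vectors =
  fixes R :: "'a::euclidean_space set"
  assumes finite_roots: "finite R"
    and nonzero: "0 \<notin> R"
    and uminus_root: "r \<in> R \<Longrightarrow> - r \<in> R"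
    and reflection: "\<lbrakk>r \<in> R; s \<in> R\<rbrakk> \<Longrightarrow> r - (2 * (r \<bullet> s) / (s \<bullet> s)) *\<^sub>R s \<in> R"
    and cartan_int: "\<lbrakk>r \<in> R; s \<in> R\<rbrakk> \<Longrightarrow> 2 * (r \<bullet> s) / (s \<bullet> s) \<in> \<int>"
    and multiple_root: "\<lbrakk>r \<in> R; c *\<^sub>R r \<in> R\<rbrakk> \<Longrightarrow> c = 1 \<or> c = -1"
    and span_roots: "span R = UNIV"
    and irreducible: "\<lbrakk>A \<union> B = R; A \<inter> B = {}; \<And>a b. \<lbrakk>a \<in> A; b \<in> B\<rbrakk> \<Longrightarrow> a \<bullet> b = 0\<rbrakk> \<Longrightarrow> A = {} \<or> B = {}"
begin

lemma orthogonal_to_roots: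
  assumes "\<And>r. r \<in> R \<Longrightarrow> r \<bullet> y = 0"
  shows "y = 0"
proof -
  have "orthogonal y y"
    by (rule orthogonal_to_span[of y R])
      (use assms span_roots in \<open>auto simp: orthogonal_def inner_commute\<close>)
  then show ?thesis
    by (simp add: orthogonal_self)
qed

text \<open>
  If both Cartan integers of \<open>r\<close> and \<open>s\<close> were at least 2, then \<open>\<parallel>r - s\<parallel>\<^sup>2 \<le> 0\<close>; so one of
  them is 1 and the corresponding reflection produces \<open>r - s\<close> up to sign.
\<close>

lemma diff_root:
  assumes r: "r \<in> R" and s: "s \<in> R" and pos: "r \<bullet> s > 0" and ne: "r \<noteq> s"
  shows "r - s \<in> R"
proof -
  have rr: "r \<bullet> r > 0" and ss: "s \<bullet> s > 0"
    using r s nonzero by (auto simp: inner_gt_zero_iff)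
  obtain m n :: int where mn: "2 * (r \<bullet> s) / (s \<bullet> s) = m" "2 * (s \<bullet> r) / (r \<bullet> r) = n"
    using cartan_int r s by (metis Ints_cases)
  have "0 < real_of_int m" "0 < real_of_int n"
    using mn rr ss pos by (simp_all add: inner_commute flip: mn)
  then have mn1: "m \<ge> 1" "n \<ge> 1"
    by linarith+
  have "m = 1 \<or> n = 1"
  proof (rule ccontr)
    assume "\<not> ?thesis"
    then have "real_of_int m \<ge> 2" "real_of_int n \<ge> 2"
      using mn1 by linarith+
    then have "2 * (r \<bullet> s) \<ge> 2 * (s \<bullet> s)" "2 * (r \<bullet> s) \<ge> 2 * (r \<bullet> r)"
      using rr ss by (simp_all add: inner_commute le_divide_eq flip: mn)
    then have "(r - s) \<bullet> (r - s) \<le> 0"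
      by (simp add: inner_diff_left inner_diff_right inner_commute)
    then show False
      using ne by (metis eq_iff_diff_eq_0 inner_gt_zero_iff not_le)
  qed
  then show ?thesis
  proof
    assume "m = 1"
    then show ?thesis
      using reflection[OF r s] mn(1) by simp
  next
    assume "n = 1"
    then have "s - r \<in> R"
      using reflection[OF s r] mn(2) by simp
    then show ?thesis
      using uminus_root by fastforce
  qed
qed

end

text \<open>
  A point on no hyperplane \<open>r \<bullet> y = k\<close> with \<open>r \<in> R\<close> and \<open>k \<in> \<int>\<close>; it singles out the alcove
  containing it.
\<close>

locale alcove = root_vectors R for R :: "'a::euclidean_space set" +
  fixes x0 :: 'a
  assumes regular: "r \<in> R \<Longrightarrow> r \<bullet> x0 \<notin> \<int>"
begin

text \<open>
  The alcove of \<open>x0\<close> is given by \<open>r \<bullet> y < level r\<close> for all roots \<open>r\<close>. As \<open>- r\<close> is a root too, the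
  lower bounds on \<open>r \<bullet> y\<close> are included.
\<close>

definition level :: "'a \<Rightarrow> int" where
  "level r = \<lceil>r \<bullet> x0\<rceil>"

text \<open>
  The closed alcove.
\<close>

definition K :: "'a set" where
  "K = {y. \<forall>r\<in>R. r \<bullet> y \<le> level r}"

lemma KD: "y \<in> K \<Longrightarrow> r \<in> R \<Longrightarrow> r \<bullet> y \<le> level r"
  by (simp add: K_def)

lemma level_bounds:
  assumes "r \<in> R"
  shows "r \<bullet> x0 < level r" "level r < r \<bullet> x0 + 1"
proof -
  have "r \<bullet> x0 \<noteq> level r"
    using regular[OF assms] by (metis Ints_of_int)
  then show "r \<bullet> x0 < level r" "level r < r \<bullet> x0 + 1"
    unfolding level_def by linarith+
qed

lemma level_uminus: "r \<in> R \<Longrightarrow> level (- r) = 1 - level r"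
  using level_bounds[of r] level_bounds[of "-r"] uminus_root[of r] by simp

text \<open>
  So one of the two constraints with normals \<open>r\<close> and \<open>s\<close> is the sum of two other constraints of the
  alcove.
\<close>

lemma level_split:
  assumes r: "r \<in> R" and s: "s \<in> R" and d: "r - s \<in> R"
  shows "level r = level s + level (r - s) \<or> level s = level r + level (s - r)"
proof -
  have "s - r \<in> R"
    using uminus_root[OF d] by simp
  then show ?thesis
    using level_bounds[OF r] level_bounds[OF s] level_bounds[OF d] level_bounds[of "s - r"]
    by (simp add: inner_diff_left) linarith
qed

text \<open>
  The set \<open>S\<close> consists of roots whose constraints alone define the closed alcove.
\<close>

definition cuts :: "'a set \<Rightarrow> bool" where
  "cuts S \<longleftrightarrow> S \<subseteq> R \<and> {y. \<forall>r\<in>S. r \<bullet> y \<le> level r} \<subseteq> K"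

lemma minimal_cut_exists: "\<exists>S. cuts S \<and> (\<forall>a\<in>S. \<not> cuts (S - {a}))"
proof -
  have "finite {S. cuts S}"
    by (rule finite_subset[of _ "Pow R"]) (auto simp: cuts_def finite_roots)
  moreover have "{S. cuts S} \<noteq> {}"
    by (auto simp: cuts_def K_def)
  ultimately obtain S where S: "cuts S" "\<And>T. cuts T \<Longrightarrow> T \<subseteq> S \<Longrightarrow> S = T"
    using finite_has_minimal[of "{S. cuts S}"] by blast
  have "\<not> cuts (S - {a})" if "a \<in> S" for a
    using S(2)[of "S - {a}"] that by blast
  with S(1) show ?thesis
    by blast
qed

end

text \<open>
  An irredundant such set \<open>S\<close>: its members are the outer normals of the walls of the alcove.
\<close>

locale alcove_walls = alcove R x0 for R :: "'a::euclidean_space set" and x0 +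
  fixes S :: "'a set"
  assumes cuts: "cuts S" and minimal: "a \<in> S \<Longrightarrow> \<not> cuts (S - {a})"
begin

lemma wall_root: "a \<in> S \<Longrightarrow> a \<in> R"
  using cuts by (auto simp: cuts_def)

lemma finite_walls: "finite S"
  using cuts finite_roots finite_subset by (auto simp: cuts_def)

lemma KI: "(\<And>a. a \<in> S \<Longrightarrow> a \<bullet> y \<le> level a) \<Longrightarrow> y \<in> K"
  using cuts by (auto simp: cuts_def)

text \<open>
  A point in the relative interior of the facet with normal \<open>a\<close>.
\<close>

lemma facet_point:
  assumes a: "a \<in> S"
  obtains z where "z \<in> K" "a \<bullet> z = level a" "\<And>b. b \<in> S \<Longrightarrow> b \<noteq> a \<Longrightarrow> b \<bullet> z < level b"
proof -
  obtain y where y: "\<And>b. b \<in> S \<Longrightarrow> b \<noteq> a \<Longrightarrow> b \<bullet> y \<le> level b" "y \<notin> K"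
    using minimal[OF a] wall_root unfolding cuts_def by blast
  have ay: "a \<bullet> y > level a"
    using KI[of y] y by (metis not_le)
  have ax: "a \<bullet> x0 < level a"
    using level_bounds(1) wall_root[OF a] .
  define t where "t = (level a - a \<bullet> x0) / (a \<bullet> y - a \<bullet> x0)"
  have t: "0 < t" "t < 1" "t * (a \<bullet> y - a \<bullet> x0) = level a - a \<bullet> x0"
    using ax ay by (auto simp: t_def)
  define z where "z = (1 - t) *\<^sub>R x0 + t *\<^sub>R y"
  have az: "a \<bullet> z = level a"
    using t(3) by (simp add: z_def inner_add_right algebra_simps)
  have bz: "b \<bullet> z < level b" if b: "b \<in> S" "b \<noteq> a" for b
  proof -
    have "(1 - t) * (b \<bullet> x0) < (1 - t) * level b"
      using t level_bounds(1)[OF wall_root[OF b(1)]] by simp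
    moreover have "t * (b \<bullet> y) \<le> t * level b"
      using t y(1)[OF b] by simp
    ultimately show ?thesis
      by (simp add: z_def inner_add_right algebra_simps)
  qed
  have "z \<in> K"
    by (rule KI) (metis az bz less_imp_le order_refl)
  then show ?thesis
    using that az bz by blast
qed

text \<open>
  Otherwise the difference of \<open>a\<close> and \<open>b\<close> is a root, and one of their two constraints is a sum of
  constraints one of which is strict on the facet in question.
\<close>

lemma obtuse:
  assumes a: "a \<in> S" and b: "b \<in> S" and ne: "a \<noteq> b"
  shows "a \<bullet> b \<le> 0"
proof (rule ccontr)
  have no: "level a \<noteq> level b + level (a - b)"
    if ab: "a \<in> S" "b \<in> S" "a \<noteq> b" "a - b \<in> R" for a b
  proof -
    obtain z where z: "z \<in> K" "a \<bullet> z = level a" "\<And>b. b \<in> S \<Longrightarrow> b \<noteq> a \<Longrightarrow> b \<bullet> z < level b"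
      using facet_point[OF ab(1)] by blast
    have "b \<bullet> z < level b" "(a - b) \<bullet> z \<le> level (a - b)"
      using ab z KD by auto
    then show ?thesis
      using z(2) by (simp add: inner_diff_left)
  qed
  assume "\<not> ?thesis"
  then have d: "a - b \<in> R"
    using diff_root wall_root a b ne by simp
  then have "b - a \<in> R"
    using uminus_root[OF d] by simp
  then show False
    using level_split[of a b] d no[of a b] no[of b a] a b ne wall_root by blast
qed

lemma recession_cone_trivial:
  assumes y: "\<And>a. a \<in> S \<Longrightarrow> a \<bullet> y \<le> 0"
  shows "y = 0"
proof (rule orthogonal_to_roots)
  have le: "r \<bullet> y \<le> 0" if r: "r \<in> R" for r
  proof (rule ccontr)
    assume "\<not> ?thesis"
    then have ry: "r \<bullet> y > 0" by simp
    define t where "t = (level r - r \<bullet> x0) / (r \<bullet> y) + 1"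
    have t: "t \<ge> 0" "t * (r \<bullet> y) = level r - r \<bullet> x0 + r \<bullet> y"
      using ry level_bounds(1)[OF r] by (auto simp: t_def field_simps)
    have "x0 + t *\<^sub>R y \<in> K"
    proof (rule KI)
      fix a assume a: "a \<in> S"
      have "t * (a \<bullet> y) \<le> 0"
        using t(1) y[OF a] by (simp add: mult_nonneg_nonpos)
      then show "a \<bullet> (x0 + t *\<^sub>R y) \<le> level a"
        using level_bounds(1)[OF wall_root[OF a]] by (simp add: inner_add_right)
    qed
    then have "r \<bullet> (x0 + t *\<^sub>R y) \<le> level r"
      using KD r by blast
    then show False
      using t(2) ry by (simp add: inner_add_right)
  qed
  show "r \<bullet> y = 0" if "r \<in> R" for r
    using le[OF that] le[OF uminus_root[OF that]] by simp
qed

text \<open>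
  The hyperplane of a root \<open>g \<noteq> a\<close> with \<open>g \<bullet> a > 0\<close> cannot contain a relatively interior point of the
  facet with normal \<open>a\<close>: it would support the alcove along the whole facet.
\<close>

lemma below_at_facet_point:
  assumes a: "a \<in> S" and g: "g \<in> R" and ne: "g \<noteq> a" and pos: "g \<bullet> a > 0"
    and z: "z \<in> K" "a \<bullet> z = level a" "\<And>b. b \<in> S \<Longrightarrow> b \<noteq> a \<Longrightarrow> b \<bullet> z < level b"
  shows "g \<bullet> z < level g"
proof (rule ccontr)
  assume "\<not> ?thesis"
  then have gz: "g \<bullet> z = level g"
    using KD[OF z(1) g] by simp
  have aa: "a \<bullet> a > 0"
    using pos by (metis inner_gt_zero_iff inner_zero_right less_irrefl)
  define d where "d = g - ((g \<bullet> a) / (a \<bullet> a)) *\<^sub>R a"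
  have ad: "a \<bullet> d = 0"
    using aa by (simp add: d_def inner_diff_right inner_commute)
  have "\<forall>\<^sub>F t in at_right 0. \<forall>b\<in>S - {a}. b \<bullet> (z + t *\<^sub>R d) < level b"
  proof -
    have "\<forall>\<^sub>F t in at_right 0. b \<bullet> (z + t *\<^sub>R d) < level b" if "b \<in> S - {a}" for b
    proof (rule order_tendstoD(2))
      show "((\<lambda>t. b \<bullet> (z + t *\<^sub>R d)) \<longlongrightarrow> b \<bullet> (z + 0 *\<^sub>R d)) (at_right 0)"
        by (intro tendsto_intros)
      show "b \<bullet> (z + 0 *\<^sub>R d) < level b"
        using z(3) that by simp
    qed
    then show ?thesis
      using finite_walls by (simp add: eventually_ball_finite_distrib)
  qed
  moreover have "\<forall>\<^sub>F t::real in at_right 0. 0 < t"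
    by (rule eventually_at_right_less)
  ultimately have "\<forall>\<^sub>F t::real in at_right 0. g \<bullet> d \<le> 0"
  proof eventually_elim
    case (elim t)
    have "z + t *\<^sub>R d \<in> K"
    proof (rule KI)
      fix b assume "b \<in> S"
      then show "b \<bullet> (z + t *\<^sub>R d) \<le> level b"
        using elim(1) z(2) ad by (cases "b = a") (auto simp: inner_add_right intro: less_imp_le)
    qed
    then have "g \<bullet> (z + t *\<^sub>R d) \<le> level g"
      using KD g by blast
    then show ?case
      using gz elim(2) by (simp add: inner_add_right mult_le_0_iff)
  qed
  then have "g \<bullet> d \<le> 0"
    by (simp add: eventually_const_iff)
  moreover have "g \<bullet> d = d \<bullet> d"
    using ad aa by (simp add: d_def inner_diff_left inner_diff_right inner_commute)
  ultimately have "d = 0"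
    by (metis inner_gt_zero_iff not_le)
  then have ga: "g = ((g \<bullet> a) / (a \<bullet> a)) *\<^sub>R a"
    by (simp add: d_def)
  then have "(g \<bullet> a) / (a \<bullet> a) = 1 \<or> (g \<bullet> a) / (a \<bullet> a) = -1"
    using multiple_root[of a "(g \<bullet> a) / (a \<bullet> a)"] g wall_root[OF a] by simp
  moreover have "(g \<bullet> a) / (a \<bullet> a) > 0"
    using pos aa by simp
  ultimately have "(g \<bullet> a) / (a \<bullet> a) = 1" by linarith
  then show False
    using ga ne by (metis scaleR_one)
qed

text \<open>
  If the walls split into two orthogonal families, so do all roots. The proof is a descent on the
  gap \<open>m - g \<bullet> x0\<close> between \<open>x0\<close> and an affine hyperplane \<open>g \<bullet> y = m\<close> outside the alcove. As
  \<open>a \<bullet> g \<le> 0\<close> for all \<open>a \<in> S\<close> would force \<open>g = 0\<close>, there is a wall \<open>a\<close> with \<open>g \<bullet> a > 0\<close>; reflecting in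
  it reduces the gap by at least a fixed \<open>e > 0\<close>, unless \<open>g = a\<close>.
\<close>

lemma root_in_wall_component:
  assumes T: "T \<subseteq> S" and orth: "\<And>a b. a \<in> T \<Longrightarrow> b \<in> S - T \<Longrightarrow> a \<bullet> b = 0"
    and g: "g \<in> R"
  shows "g \<in> span T \<or> g \<in> span (S - T)"
proof -
  have span_orth: "u \<bullet> v = 0" if "u \<in> span T" "v \<in> span (S - T)" for u v
    using orthogonal_spans[OF orth that] .
  have "S \<noteq> {}"
  proof
    assume "S = {}"
    then have "g = 0"
      using recession_cone_trivial by blast
    then show False
      using g nonzero by simp
  qed
  define e where "e = Min ((\<lambda>a. level a - a \<bullet> x0) ` S)"
  have e0: "e > 0"
    unfolding e_def using finite_walls \<open>S \<noteq> {}\<close> level_bounds(1) wall_root by auto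
  have ele: "e \<le> level a - a \<bullet> x0" if "a \<in> S" for a
    unfolding e_def using finite_walls that by (intro Min_le) auto
  have "g \<in> span T \<or> g \<in> span (S - T)" if "g \<in> R" "g \<bullet> x0 < of_int m" "of_int m - g \<bullet> x0 < of_nat N * e"
    for g :: 'a and m :: int and N
    using that
  proof (induction N arbitrary: g m)
    case 0
    then show ?case by simp
  next
    case (Suc N)
    have "\<exists>a\<in>S. g \<bullet> a > 0"
    proof (rule ccontr)
      assume no: "\<not> ?thesis"
      have "g = 0"
      proof (rule recession_cone_trivial)
        fix a assume "a \<in> S"
        then show "a \<bullet> g \<le> 0"
          using no by (metis inner_commute not_le)
      qed
      then show False
        using Suc.prems(1) nonzero by blast
    qed
    then obtain a where a: "a \<in> S" "g \<bullet> a > 0" by blast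
    show ?case
    proof (cases "g = a")
      case True
      then show ?thesis
        using a(1) span_base[of a T] span_base[of a "S - T"] by auto
    next
      case False
      have aR: "a \<in> R" using wall_root a by blast
      have aa: "a \<bullet> a > 0"
        using a(2) by (metis inner_gt_zero_iff inner_zero_right less_irrefl)
      obtain n :: int where n: "2 * (g \<bullet> a) / (a \<bullet> a) = n"
        using cartan_int[OF Suc.prems(1) aR] by (metis Ints_cases)
      have "0 < real_of_int n"
        using aa a(2) by (simp flip: n)
      then have n1: "real_of_int n \<ge> 1" by simp
      define g' where "g' = g - real_of_int n *\<^sub>R a"
      define m' where "m' = m - n * level a"
      have g': "g' \<in> R"
        using reflection[OF Suc.prems(1) aR] n by (simp add: g'_def)
      obtain z where z: "z \<in> K" "a \<bullet> z = level a" "\<And>b. b \<in> S \<Longrightarrow> b \<noteq> a \<Longrightarrow> b \<bullet> z < level b"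
        using facet_point[OF a(1)] by blast
      have "level g \<le> m"
        using Suc.prems(2) by (simp add: level_def ceiling_le_iff)
      \<comment> \<open>The reflected hyperplane is strictly beyond \<open>z\<close>, hence beyond \<open>x0\<close>: hyperplanes do not
        separate points of the closed alcove.\<close>
      then have "g \<bullet> z < m"
        using below_at_facet_point[OF a(1) Suc.prems(1) False a(2) z] by linarith
      then have "g' \<bullet> z < m'"
        by (simp add: g'_def m'_def inner_diff_left z(2))
      moreover have "- g' \<bullet> z \<le> level (- g')"
        using KD[OF z(1) uminus_root[OF g']] .
      ultimately have "m' \<ge> level g'"
        using level_uminus[OF g'] by simp
      then have lt: "g' \<bullet> x0 < m'"
        using level_bounds(1)[OF g'] by linarith
      have "e \<le> n * (level a - a \<bullet> x0)"
        using mult_mono[OF n1 ele[OF a(1)]] e0 n1 by simp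
      then have "of_int m' - g' \<bullet> x0 < of_nat N * e"
        using Suc.prems(3) by (simp add: g'_def m'_def inner_diff_left algebra_simps)
      from Suc.IH[OF g' lt this] have g'T: "g' \<in> span T \<or> g' \<in> span (S - T)" .
      have "g' \<bullet> a = - (g \<bullet> a)"
        using aa by (simp add: g'_def inner_diff_left flip: n)
      then have neg: "g' \<bullet> a < 0"
        using a(2) by simp
      have gg: "g = g' + real_of_int n *\<^sub>R a"
        by (simp add: g'_def)
      \<comment> \<open>The root \<open>g'\<close> is not orthogonal to \<open>a\<close>, so the two lie in the same component.\<close>
      show ?thesis
      proof (cases "a \<in> T")
        case True
        then have aT: "a \<in> span T" by (rule span_base)
        then have "g' \<in> span T"
          using g'T span_orth[OF aT] neg by (force simp: inner_commute)
        then show ?thesis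
          using aT unfolding gg by (simp add: span_add span_scale)
      next
        case False
        then have aT: "a \<in> span (S - T)" using a(1) by (auto intro: span_base)
        then have "g' \<in> span (S - T)"
          using g'T span_orth[OF _ aT] neg by force
        then show ?thesis
          using aT unfolding gg by (simp add: span_add span_scale)
      qed
    qed
  qed
  moreover obtain N :: nat where "level g - g \<bullet> x0 < of_nat N * e"
    using reals_Archimedean3[OF e0] by blast
  ultimately show ?thesis
    using g level_bounds(1)[OF g] by blast
qed

end

section \<open>Alcoves and cells are simplices\<close>

context alcove_walls
begin

lemma walls_nonempty: "S \<noteq> {}"
proof
  assume "S = {}"
  then have "b = 0" for b
    using recession_cone_trivial by blast
  then show False
    using nonempty_Basis nonzero_Basis by blast
qed

text \<open>
  By obtuseness the support \<open>T\<close> of a nonnegative dependency is orthogonal to the remaining walls,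
  so irreducibility leaves nothing outside \<open>T\<close>.
\<close>

lemma nonneg_dependency_full:
  assumes c: "\<And>a. a \<in> S \<Longrightarrow> c a \<ge> 0" and dep: "(\<Sum>a\<in>S. c a *\<^sub>R a) = 0"
    and a0: "a0 \<in> S" "c a0 > 0" and b: "b \<in> S"
  shows "c b > 0"
proof -
  define T where "T = {a \<in> S. c a > 0}"
  have T: "T \<subseteq> S" "a0 \<in> T"
    using a0 by (auto simp: T_def)
  have orth: "a \<bullet> b = 0" if a: "a \<in> T" and b: "b \<in> S - T" for a b
  proof -
    have cb: "c b = 0"
      using b c[of b] by (force simp: T_def)
    have "c a * (a \<bullet> b) \<le> 0" if "a \<in> S" for a
      using obtuse[OF that, of b] b c[OF that] cb by (cases "a = b") (auto simp: mult_nonneg_nonpos)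
    then have nonneg: "0 \<le> c a * (- (a \<bullet> b))" if "a \<in> S" for a
      using that by simp
    have "(\<Sum>a\<in>S. c a * (a \<bullet> b)) = (\<Sum>a\<in>S. c a *\<^sub>R a) \<bullet> b"
      by (simp add: inner_sum_left)
    then have "(\<Sum>a\<in>S. c a * (- (a \<bullet> b))) = 0"
      using dep by (simp add: sum_negf)
    then have "c a * (- (a \<bullet> b)) = 0"
      using sum_nonneg_eq_0_iff[OF finite_walls, of "\<lambda>a. c a * (- (a \<bullet> b))"] nonneg a T(1) by blast
    then show ?thesis
      using a by (simp add: T_def)
  qed
  have span_orth: "u \<bullet> v = 0" if "u \<in> span T" "v \<in> span (S - T)" for u v
    using orthogonal_spans[OF orth that] .
  have "R \<inter> span T = {} \<or> R \<inter> span (S - T) = {}"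
  proof (rule irreducible)
    show "R \<inter> span T \<union> R \<inter> span (S - T) = R"
      using root_in_wall_component[OF T(1) orth] by blast
    have "r = 0" if "r \<in> span T" "r \<in> span (S - T)" for r
      using span_orth[OF that] by simp
    then show "R \<inter> span T \<inter> (R \<inter> span (S - T)) = {}"
      using nonzero by blast
  qed (use span_orth in blast)
  moreover have "a0 \<in> R \<inter> span T"
    using T wall_root by (auto intro: span_base)
  moreover have "b \<in> R \<inter> span (S - T)" if "b \<notin> T"
    using b that wall_root by (auto intro: span_base)
  ultimately show ?thesis
    by (auto simp: T_def)
qed

text \<open>
  Splitting the coefficients into positive and negative parts gives two expressions for one vector
  \<open>v\<close> with \<open>v \<bullet> v \<le> 0\<close>; both parts are then nonnegative dependencies.
\<close>

lemma dependency_sign: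
  assumes dep: "(\<Sum>a\<in>S. c a *\<^sub>R a) = 0" and a0: "a0 \<in> S" "c a0 \<noteq> 0"
  shows "(\<forall>a\<in>S. c a > 0) \<or> (\<forall>a\<in>S. c a < 0)"
proof -
  define p where "p a = max (c a) 0" for a
  define n where "n a = max (- c a) 0" for a
  have pn: "c a = p a - n a" "p a * n a = 0" "p a \<ge> 0" "n a \<ge> 0" for a
    by (auto simp: p_def n_def max_def)
  define v where "v = (\<Sum>a\<in>S. p a *\<^sub>R a)"
  have vn: "v = (\<Sum>a\<in>S. n a *\<^sub>R a)"
    using dep by (simp add: v_def pn(1) scaleR_diff_left sum_subtractf)
  have "v \<bullet> v = (\<Sum>a\<in>S. p a *\<^sub>R a) \<bullet> (\<Sum>a\<in>S. n a *\<^sub>R a)"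
    using vn v_def by simp
  also have "\<dots> = (\<Sum>a\<in>S. \<Sum>b\<in>S. (p a * n b) * (a \<bullet> b))"
    by (simp add: inner_sum_left inner_sum_right sum_distrib_left mult_ac) (rule sum.swap)
  also have "\<dots> \<le> 0"
  proof (intro sum_nonpos)
    fix a b assume ab: "a \<in> S" "b \<in> S"
    show "(p a * n b) * (a \<bullet> b) \<le> 0"
    proof (cases "a = b")
      case False
      show ?thesis
        using obtuse[OF ab False] pn(3)[of a] pn(4)[of b]
        by (intro mult_nonneg_nonpos mult_nonneg_nonneg)
    next
      case True
      then show ?thesis
        using pn(2)[of b] by auto
    qed
  qed
  finally have v0: "v = 0"
    by (metis inner_gt_zero_iff not_le)
  show ?thesis
  proof (cases "c a0 > 0")
    case True
    then have "p b > 0" if "b \<in> S" for b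
      using nonneg_dependency_full[of p a0 b] pn(3) v0 a0(1) that by (simp add: v_def p_def)
    then show ?thesis
      by (force simp: p_def)
  next
    case False
    then have "n a0 > 0"
      using a0(2) by (simp add: n_def)
    then have "n b > 0" if "b \<in> S" for b
      using nonneg_dependency_full[of n a0 b] pn(4) v0 a0(1) that by (simp add: vn)
    then show ?thesis
      by (force simp: n_def)
  qed
qed

lemma prescribed_values:
  fixes T :: "'a set" and \<phi> :: "'a \<Rightarrow> real"
  assumes "independent T"
  shows "\<exists>v. \<forall>b\<in>T. b \<bullet> v = \<phi> b"
proof -
  obtain g :: "'a \<Rightarrow> real" where g: "linear g" "\<And>x. x \<in> T \<Longrightarrow> g x = \<phi> x"
    using linear_independent_extend[OF assms, of \<phi>] by blast
  obtain p :: "'a dual" where p: "\<And>x. p x = g x"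
    using g(1) bounded_linear_Blinfun_apply linear_conv_bounded_linear by metis
  have "b \<bullet> riesz p = \<phi> b" if "b \<in> T" for b
    using g(2)[OF that] by (metis inner_commute p riesz_inner)
  then show ?thesis
    by blast
qed

text \<open>
  The walls are dependent because the recession cone of the alcove is trivial: otherwise some \<open>v\<close>
  would satisfy \<open>a \<bullet> v = -1\<close> for all \<open>a \<in> S\<close>.
\<close>

lemma positive_dependency:
  obtains c where "\<And>a. a \<in> S \<Longrightarrow> c a > 0" "(\<Sum>a\<in>S. c a *\<^sub>R a) = 0"
proof -
  have "dependent S"
  proof (rule ccontr)
    assume "\<not> ?thesis"
    then obtain v where v: "\<forall>b\<in>S. b \<bullet> v = -1"
      using prescribed_values[of S "\<lambda>_. -1"] by blast
    then have "v = 0"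
      by (intro recession_cone_trivial) simp
    then show False
      using v walls_nonempty by auto
  qed
  then obtain c a0 where c: "a0 \<in> S" "c a0 \<noteq> 0" "(\<Sum>a\<in>S. c a *\<^sub>R a) = 0"
    using dependent_finite[OF finite_walls] by blast
  from dependency_sign[OF c(3) c(1,2)] show ?thesis
  proof
    assume "\<forall>a\<in>S. c a > 0"
    then show ?thesis using that c(3) by blast
  next
    assume "\<forall>a\<in>S. c a < 0"
    then show ?thesis
      using that[of "\<lambda>a. - c a"] c(3) by (simp add: sum_negf)
  qed
qed

lemma independent_minus:
  assumes a: "a \<in> S"
  shows "independent (S - {a})"
proof
  assume "dependent (S - {a})"
  then obtain c a0 where c: "a0 \<in> S - {a}" "c a0 \<noteq> 0" "(\<Sum>b\<in>S - {a}. c b *\<^sub>R b) = 0"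
    using dependent_finite[of "S - {a}"] finite_walls by blast
  define c' where "c' = c(a := 0)"
  have "(\<Sum>b\<in>S. c' b *\<^sub>R b) = (\<Sum>b\<in>S - {a}. c' b *\<^sub>R b)"
    using finite_walls a by (simp add: sum.remove c'_def)
  also have "\<dots> = 0"
    using c(3) by (simp add: c'_def)
  finally show False
    using dependency_sign[of c' a0] c(1,2) a by (auto simp: c'_def)
qed

text \<open>
  The closed alcove is a simplex. The vertices \<open>v a\<close> and the barycentric coordinates \<open>\<beta> a\<close> are
  indexed by the walls: \<open>v a\<close> is the vertex opposite to the facet with normal \<open>a\<close>, and \<open>\<beta> a\<close> is a
  positive multiple of the affine function that vanishes on that facet. The scaling is dictated
  by the positive dependency \<open>c\<close> of the walls.
\<close>

lemma alcove_barycentric: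
  obtains v :: "'a \<Rightarrow> 'a" and \<beta> :: "'a \<Rightarrow> 'a \<Rightarrow> real" and w :: "'a \<Rightarrow> real"
  where "\<And>a. a \<in> S \<Longrightarrow> w a > 0"
    and "\<And>a y. a \<in> S \<Longrightarrow> \<beta> a y = w a * (level a - a \<bullet> y)"
    and "\<And>y. (\<Sum>a\<in>S. \<beta> a y) = 1"
    and "\<And>y. (\<Sum>a\<in>S. \<beta> a y *\<^sub>R v a) = y"
    and "\<And>a b. a \<in> S \<Longrightarrow> b \<in> S \<Longrightarrow> \<beta> a (v b) = (if a = b then 1 else 0)"
proof -
  obtain c where c: "\<And>a. a \<in> S \<Longrightarrow> c a > 0" "(\<Sum>a\<in>S. c a *\<^sub>R a) = 0"
    by (rule positive_dependency) (rule that)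
  have "\<forall>a\<in>S. \<exists>v. \<forall>b\<in>S - {a}. b \<bullet> v = level b"
    by (rule ballI) (rule prescribed_values[OF independent_minus])
  from bchoice[OF this] obtain v where "\<forall>a\<in>S. \<forall>b\<in>S - {a}. b \<bullet> v a = level b" ..
  then have v: "b \<bullet> v a = level b" if "a \<in> S" "b \<in> S" "b \<noteq> a" for a b
    using that by simp
  define D where "D = (\<Sum>a\<in>S. c a * level a)"
  have c0: "(\<Sum>a\<in>S. c a * (a \<bullet> y)) = 0" for y
  proof -
    have "(\<Sum>a\<in>S. c a * (a \<bullet> y)) = (\<Sum>a\<in>S. c a *\<^sub>R a) \<bullet> y"
      by (simp add: inner_sum_left)
    then show ?thesis
      using c(2) by simp
  qed
  then have cD: "(\<Sum>a\<in>S. c a * (level a - a \<bullet> y)) = D" for y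
    by (simp add: D_def right_diff_distrib sum_subtractf)
  have "0 < (\<Sum>a\<in>S. c a * (level a - a \<bullet> x0))"
    using finite_walls walls_nonempty c(1) level_bounds(1) wall_root
    by (intro sum_pos) auto
  then have D: "D > 0"
    by (simp only: cD)
  define w where "w a = c a / D" for a
  define \<beta> where "\<beta> a y = w a * (level a - a \<bullet> y)" for a y
  have w: "w a > 0" if "a \<in> S" for a
    using c(1)[OF that] D by (simp add: w_def)
  have sum1: "(\<Sum>a\<in>S. \<beta> a y) = 1" for y
  proof -
    have "(\<Sum>a\<in>S. \<beta> a y) = (\<Sum>a\<in>S. c a * (level a - a \<bullet> y)) / D"
      by (simp add: \<beta>_def w_def sum_divide_distrib)
    then show ?thesis
      using D unfolding cD by simp
  qed
  have ne: "\<beta> a (v b) = 0" if "a \<in> S" "b \<in> S" "a \<noteq> b" for a b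
    using v[OF that(2,1)] that(3) by (simp add: \<beta>_def)
  have one: "\<beta> a (v a) = 1" if a: "a \<in> S" for a
  proof -
    have "(\<Sum>b\<in>S. \<beta> b (v a)) = \<beta> a (v a)"
      using finite_walls a ne by (simp add: sum.remove[OF _ a])
    then show ?thesis
      using sum1 by simp
  qed
  have rep: "(\<Sum>a\<in>S. \<beta> a y *\<^sub>R v a) = y" for y
  proof -
    have "b \<bullet> (\<Sum>a\<in>S. \<beta> a y *\<^sub>R v a) = b \<bullet> y" if b: "b \<in> S" for b
    proof -
      have "level b - b \<bullet> (\<Sum>a\<in>S. \<beta> a y *\<^sub>R v a) = (\<Sum>a\<in>S. \<beta> a y * (level b - b \<bullet> v a))"
        by (simp add: inner_sum_right right_diff_distrib sum_subtractf sum1 flip: sum_distrib_right)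
      also have "\<dots> = \<beta> b y * (level b - b \<bullet> v b) + (\<Sum>a\<in>S - {b}. \<beta> a y * (level b - b \<bullet> v a))"
        using finite_walls b by (rule sum.remove)
      also have "(\<Sum>a\<in>S - {b}. \<beta> a y * (level b - b \<bullet> v a)) = 0"
        by (rule sum.neutral) (use v b in auto)
      also have "\<beta> b y * (level b - b \<bullet> v b) + 0 = level b - b \<bullet> y"
      proof -
        have "\<beta> b y * (level b - b \<bullet> v b) = \<beta> b (v b) * (level b - b \<bullet> y)"
          by (simp add: \<beta>_def)
        then show ?thesis
          by (simp only: one[OF b] mult_1 add_0_right)
      qed
      finally show ?thesis by simp
    qed
    then have "(\<Sum>a\<in>S. \<beta> a y *\<^sub>R v a) - y = 0"
      by (intro recession_cone_trivial) (simp add: inner_diff_right)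
    then show ?thesis by simp
  qed
  show ?thesis
  proof (rule that[of w \<beta> v])
    show "\<beta> a (v b) = (if a = b then 1 else 0)" if "a \<in> S" "b \<in> S" for a b
      using that ne one by simp
    show "\<beta> a y = w a * (level a - a \<bullet> y)" for a y
      by (rule \<beta>_def)
  qed (rule w rep sum1; assumption?)+
qed

end

context root_vectors
begin

text \<open>
  Two points lie in the same cell if they lie on the same side of every hyperplane. For \<open>y\<close> on the
  positive side both listed conditions fail.
\<close>

definition same_cell :: "'a \<Rightarrow> 'a \<Rightarrow> bool" where
  "same_cell x y \<longleftrightarrow> (\<forall>r\<in>R. \<forall>k::int. (r \<bullet> y = k \<longleftrightarrow> r \<bullet> x = k) \<and> (r \<bullet> y < k \<longleftrightarrow> r \<bullet> x < k))"

end

lemma zero_pos_sum: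
  fixes u \<phi> :: "'b \<Rightarrow> real"
  assumes "finite I" and u: "\<And>i. i \<in> I \<Longrightarrow> u i > 0" and \<phi>: "\<And>i. i \<in> I \<Longrightarrow> \<phi> i \<ge> 0"
  shows "(\<Sum>i\<in>I. u i * \<phi> i) = 0 \<longleftrightarrow> (\<forall>i\<in>I. \<phi> i = 0)" and "(\<Sum>i\<in>I. u i * \<phi> i) \<ge> 0"
proof -
  have nonneg: "0 \<le> u i * \<phi> i" if "i \<in> I" for i
    using u[OF that] \<phi>[OF that] by simp
  then show "(\<Sum>i\<in>I. u i * \<phi> i) \<ge> 0"
    by (rule sum_nonneg)
  show "(\<Sum>i\<in>I. u i * \<phi> i) = 0 \<longleftrightarrow> (\<forall>i\<in>I. \<phi> i = 0)"
    using sum_nonneg_eq_0_iff[OF assms(1) nonneg] u by force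
qed

context alcove_walls
begin

text \<open>
  The cell of a point \<open>x\<close> of the closed alcove consists of the points with the same barycentric
  support as \<open>x\<close>: the support records on which walls a point lies, and conversely each function
  \<open>k - r \<bullet> y\<close> has constant weak sign on the alcove, so whether it vanishes at \<open>x\<close> depends only on the
  vertices in the support. The last conclusion says that the vertices of the cell satisfy every
  weak integral inequality that \<open>x\<close> satisfies.
\<close>

lemma cell_is_open_simplex:
  assumes xK: "x \<in> K"
  obtains V where "finite V" "\<not> affine_dependent V"
    "{y. same_cell x y} = rel_interior (convex hull V)"
    "\<And>v. v \<in> V \<Longrightarrow> {y. same_cell v y} = {v}"
    "\<And>v r k. \<lbrakk>v \<in> V; r \<in> R; r \<bullet> x \<le> of_int k\<rbrakk> \<Longrightarrow> r \<bullet> v \<le> of_int k"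
proof -
  obtain v :: "'a \<Rightarrow> 'a" and \<beta> :: "'a \<Rightarrow> 'a \<Rightarrow> real" and w
    where w: "\<And>a. a \<in> S \<Longrightarrow> w a > 0"
      and \<beta>: "\<And>a y. a \<in> S \<Longrightarrow> \<beta> a y = w a * (level a - a \<bullet> y)"
      and sum1: "\<And>y. (\<Sum>a\<in>S. \<beta> a y) = 1"
      and rep: "\<And>y. (\<Sum>a\<in>S. \<beta> a y *\<^sub>R v a) = y"
      and delta: "\<And>a b. a \<in> S \<Longrightarrow> b \<in> S \<Longrightarrow> \<beta> a (v b) = (if a = b then 1 else 0)"
    by (rule alcove_barycentric) (rule that)
  define I where "I x = {a \<in> S. \<beta> a x > 0}" for x
  have fin: "finite (I x)" and IS: "I x \<subseteq> S" for x
    using finite_walls by (auto simp: I_def)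
  have \<beta>0: "\<beta> a y \<ge> 0" if "y \<in> K" "a \<in> S" for a y
    using \<beta>[OF that(2)] KD[OF that(1) wall_root[OF that(2)]] w[OF that(2)] by simp
  have sumI: "(\<Sum>a\<in>I y. g a (\<beta> a y)) = (\<Sum>a\<in>S. g a (\<beta> a y))"
    if "y \<in> K" "\<And>a. g a 0 = 0" for y and g :: "'a \<Rightarrow> real \<Rightarrow> 'b::real_vector"
    using finite_walls IS \<beta>0[OF that(1)] that(2)
    by (intro sum.mono_neutral_left) (force simp: I_def)+
  have sumI1: "(\<Sum>a\<in>I y. \<beta> a y) = 1" and sumIv: "(\<Sum>a\<in>I y. \<beta> a y *\<^sub>R v a) = y"
    if "y \<in> K" for y
    using sumI[OF that, of "\<lambda>a t. t"] sumI[OF that, of "\<lambda>a t. t *\<^sub>R v a"] sum1 rep by auto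
  have vK: "v a \<in> K" if "a \<in> S" for a
  proof (rule KI)
    fix b assume b: "b \<in> S"
    then have "0 \<le> w b * (level b - b \<bullet> v a)"
      using \<beta>[OF b] delta[OF b that] by (metis order_refl zero_le_one)
    then show "b \<bullet> v a \<le> level b"
      using w[OF b] by (simp add: zero_le_mult_iff)
  qed
  have inj: "inj_on v S"
    by (rule inj_onI) (metis delta zero_neq_one)
  have affine_value: "k - r \<bullet> y = (\<Sum>a\<in>J. u a * (k - r \<bullet> v a))"
    if "sum u J = 1" "(\<Sum>a\<in>J. u a *\<^sub>R v a) = y" for u J y r and k :: real
    using that by (auto simp: inner_sum_right right_diff_distrib sum_subtractf simp flip: sum_distrib_right)
  \<comment> \<open>No hyperplane of the arrangement meets the interior of the alcove.\<close>
  have side: "(\<forall>z\<in>K. r \<bullet> z \<le> k) \<or> (\<forall>z\<in>K. r \<bullet> z \<ge> k)" if r: "r \<in> R" for r and k :: int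
  proof (cases "level r \<le> k")
    case True
    then show ?thesis
      using KD[OF _ r] by force
  next
    case False
    have "r \<bullet> z \<ge> k" if "z \<in> K" for z
      using KD[OF that uminus_root[OF r]] level_uminus[OF r] False by simp
    then show ?thesis by blast
  qed
  have cell: "{y. same_cell x y} = {y. \<exists>u. (\<forall>a\<in>I x. 0 < u a) \<and> sum u (I x) = 1 \<and> (\<Sum>a\<in>I x. u a *\<^sub>R v a) = y}"
    (is "_ = ?E") if xK: "x \<in> K" for x
  proof (intro equalityI subsetI)
    fix y assume "y \<in> {y. same_cell x y}"
    then have sc: "same_cell x y" by simp
    have le: "r \<bullet> y \<le> of_int k \<longleftrightarrow> r \<bullet> x \<le> of_int k" if "r \<in> R" for r k
      using sc that unfolding same_cell_def by (metis order_le_less)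
    have yK: "y \<in> K"
      using xK le by (auto simp: K_def)
    have "\<beta> a y > 0 \<longleftrightarrow> \<beta> a x > 0" if a: "a \<in> S" for a
      using \<beta>[OF a] w[OF a] sc wall_root[OF a] by (simp add: same_cell_def zero_less_mult_iff)
    then have "I y = I x"
      by (auto simp: I_def)
    then show "y \<in> ?E"
      using sumI1[OF yK] sumIv[OF yK] by (auto simp: I_def intro!: exI[of _ "\<lambda>a. \<beta> a y"])
  next
    fix y assume "y \<in> ?E"
    then obtain u where u: "\<And>a. a \<in> I x \<Longrightarrow> 0 < u a" "sum u (I x) = 1" "(\<Sum>a\<in>I x. u a *\<^sub>R v a) = y"
      by blast
    have \<beta>x: "0 < \<beta> a x" if "a \<in> I x" for a
      using that by (simp add: I_def)
    have "(r \<bullet> y = k \<longleftrightarrow> r \<bullet> x = k) \<and> (r \<bullet> y < k \<longleftrightarrow> r \<bullet> x < k)" if r: "r \<in> R" for r and k :: int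
    proof -
      have y: "k - r \<bullet> y = (\<Sum>a\<in>I x. u a * (k - r \<bullet> v a))"
        by (rule affine_value) (use u in auto)
      have x: "k - r \<bullet> x = (\<Sum>a\<in>I x. \<beta> a x * (k - r \<bullet> v a))"
        by (rule affine_value) (use sumI1 sumIv xK in auto)
      have y': "r \<bullet> y - k = (\<Sum>a\<in>I x. u a * (r \<bullet> v a - k))"
        using y by (simp add: right_diff_distrib sum_subtractf)
      have x': "r \<bullet> x - k = (\<Sum>a\<in>I x. \<beta> a x * (r \<bullet> v a - k))"
        using x by (simp add: right_diff_distrib sum_subtractf)
      from side[OF r, of k] show ?thesis
      proof
        assume le: "\<forall>z\<in>K. r \<bullet> z \<le> k"
        then have nn: "k - r \<bullet> v a \<ge> 0" if "a \<in> I x" for a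
          using vK IS that by fastforce
        let ?\<phi> = "\<lambda>a. k - r \<bullet> v a"
        note zero_pos_sum[where \<phi> = ?\<phi> and I = "I x" and u = u, OF fin u(1) nn]
          zero_pos_sum[where \<phi> = ?\<phi> and I = "I x" and u = "\<lambda>a. \<beta> a x", OF fin \<beta>x nn]
        then show ?thesis
          using x y by auto
      next
        assume "\<forall>z\<in>K. r \<bullet> z \<ge> k"
        then have nn: "r \<bullet> v a - k \<ge> 0" if "a \<in> I x" for a
          using vK IS that by fastforce
        let ?\<phi> = "\<lambda>a. r \<bullet> v a - k"
        note zero_pos_sum[where \<phi> = ?\<phi> and I = "I x" and u = u, OF fin u(1) nn]
          zero_pos_sum[where \<phi> = ?\<phi> and I = "I x" and u = "\<lambda>a. \<beta> a x", OF fin \<beta>x nn]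
        then show ?thesis
          using x' y' by auto
      qed
    qed
    then show "y \<in> {y. same_cell x y}"
      by (simp add: same_cell_def)
  qed
  define V where "V = v ` I x"
  have injI: "inj_on v (I x)"
    using inj IS inj_on_subset by blast
  have finV: "finite V"
    using fin by (simp add: V_def)
  have indep: "\<not> affine_dependent V"
  proof
    assume "affine_dependent V"
    then obtain U t where U: "sum U V = 0" "t \<in> V" "U t \<noteq> 0" "(\<Sum>t\<in>V. U t *\<^sub>R t) = 0"
      using affine_dependent_explicit_finite[OF finV] by blast
    then obtain a where a: "a \<in> I x" "t = v a"
      by (auto simp: V_def)
    have aS: "a \<in> S" using a IS by blast
    have s: "(\<Sum>b\<in>I x. U (v b)) = 0" "(\<Sum>b\<in>I x. U (v b) *\<^sub>R v b) = 0"
      using U(1,4) by (simp_all add: V_def sum.reindex[OF injI] o_def)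
    have "U (v a) = (\<Sum>b\<in>I x. if a = b then U (v b) else 0)"
      using fin a(1) by simp
    also have "\<dots> = (\<Sum>b\<in>I x. U (v b) * \<beta> a (v b))"
      by (intro sum.cong) (simp_all add: delta[OF aS subsetD[OF IS]])
    also have "\<dots> = w a * (level a * (\<Sum>b\<in>I x. U (v b)) - a \<bullet> (\<Sum>b\<in>I x. U (v b) *\<^sub>R v b))"
      by (simp add: \<beta>[OF aS] inner_sum_right sum_distrib_left right_diff_distrib sum_subtractf mult_ac)
    also have "\<dots> = 0"
      by (simp add: s)
    finally show False
      using U(3) a(2) by simp
  qed
  have "{y. same_cell x y} = rel_interior (convex hull V)"
  proof -
    have "(\<exists>u. (\<forall>a\<in>I x. 0 < u a) \<and> sum u (I x) = 1 \<and> (\<Sum>a\<in>I x. u a *\<^sub>R v a) = y)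
        \<longleftrightarrow> (\<exists>u. (\<forall>t\<in>V. 0 < u t) \<and> sum u V = 1 \<and> (\<Sum>t\<in>V. u t *\<^sub>R t) = y)" for y
    proof
      assume "\<exists>u. (\<forall>a\<in>I x. 0 < u a) \<and> sum u (I x) = 1 \<and> (\<Sum>a\<in>I x. u a *\<^sub>R v a) = y"
      then obtain u where u: "\<forall>a\<in>I x. 0 < u a" "sum u (I x) = 1" "(\<Sum>a\<in>I x. u a *\<^sub>R v a) = y"
        by blast
      show "\<exists>u. (\<forall>t\<in>V. 0 < u t) \<and> sum u V = 1 \<and> (\<Sum>t\<in>V. u t *\<^sub>R t) = y"
        by (rule exI[of _ "u \<circ> the_inv_into (I x) v"])
          (use u injI in \<open>simp add: V_def sum.reindex[OF injI] the_inv_into_f_f cong: sum.cong\<close>)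
    next
      assume "\<exists>u. (\<forall>t\<in>V. 0 < u t) \<and> sum u V = 1 \<and> (\<Sum>t\<in>V. u t *\<^sub>R t) = y"
      then obtain u where u: "\<forall>t\<in>V. 0 < u t" "sum u V = 1" "(\<Sum>t\<in>V. u t *\<^sub>R t) = y"
        by blast
      show "\<exists>u. (\<forall>a\<in>I x. 0 < u a) \<and> sum u (I x) = 1 \<and> (\<Sum>a\<in>I x. u a *\<^sub>R v a) = y"
        by (rule exI[of _ "u \<circ> v"]) (use u in \<open>simp add: V_def sum.reindex[OF injI]\<close>)
    qed
    then show ?thesis
      by (simp add: cell[OF xK] rel_interior_convex_hull_explicit[OF indep])
  qed
  moreover have "{y. same_cell t y} = {t}" if t: "t \<in> V" for t
  proof -
    obtain a where a: "a \<in> S" "t = v a"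
      using t IS by (auto simp: V_def)
    have "I (v a) = {a}"
      using a delta by (auto simp: I_def split: if_splits)
    then have "{y. same_cell (v a) y} = {y. \<exists>u. 0 < u a \<and> u a = 1 \<and> u a *\<^sub>R v a = y}"
      using cell[OF vK[OF a(1)]] by simp
    also have "\<dots> = {v a}"
      by (auto intro!: exI[of _ "\<lambda>_. 1::real"])
    finally show ?thesis
      by (simp only: a(2))
  qed
  moreover have "r \<bullet> t \<le> of_int k" if t: "t \<in> V" and r: "r \<in> R" and k: "r \<bullet> x \<le> of_int k" for t r k
  proof -
    obtain a where a: "a \<in> I x" "t = v a"
      using t by (auto simp: V_def)
    from side[OF r, of k] show ?thesis
    proof
      assume "\<forall>z\<in>K. r \<bullet> z \<le> k"
      then show ?thesis
        using vK a IS by blast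
    next
      assume ge: "\<forall>z\<in>K. r \<bullet> z \<ge> k"
      then have nonneg: "r \<bullet> v b - k \<ge> 0" if "b \<in> I x" for b
        using vK IS that by fastforce
      have "k - r \<bullet> x = (\<Sum>b\<in>I x. \<beta> b x * (k - r \<bullet> v b))"
        by (rule affine_value) (use sumI1 sumIv xK in auto)
      then have "(\<Sum>b\<in>I x. \<beta> b x * (r \<bullet> v b - k)) = 0"
        using k ge xK by (force simp: right_diff_distrib sum_subtractf)
      then have "r \<bullet> v a - k = 0"
        using zero_pos_sum(1)[OF fin, of x "\<lambda>b. \<beta> b x" "\<lambda>b. r \<bullet> v b - k"] nonneg a(1)
        by (auto simp: I_def)
      then show ?thesis
        using a(2) by simp
    qed
  qed
  ultimately show ?thesis
    by (rule that[OF finV indep])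
qed

end

lemma generic_vector:
  fixes F :: "'a::real_inner set"
  assumes "finite F" "0 \<notin> F"
  shows "\<exists>w. \<forall>r\<in>F. r \<bullet> w \<noteq> 0"
  using assms
proof (induction F)
  case empty
  then show ?case by simp
next
  case (insert r F)
  then obtain w where w: "\<And>s. s \<in> F \<Longrightarrow> s \<bullet> w \<noteq> 0"
    by blast
  have "finite ((\<lambda>s. - (s \<bullet> w) / (s \<bullet> r)) ` insert r F)"
    using insert by simp
  then obtain t where t: "t \<notin> (\<lambda>s. - (s \<bullet> w) / (s \<bullet> r)) ` insert r F"
    using infinite_UNIV_char_0 ex_new_if_finite by blast
  have "s \<bullet> (w + t *\<^sub>R r) \<noteq> 0" if s: "s \<in> insert r F" for s
  proof (cases "s \<bullet> r = 0")
    case True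
    then have "s \<noteq> r"
      using insert.prems by auto
    then show ?thesis
      using True w s by (simp add: inner_add_right)
  next
    case False
    then show ?thesis
      using t s by (force simp: inner_add_right field_simps eq_neg_iff_add_eq_0)
  qed
  then show ?case by blast
qed

context root_vectors
begin

text \<open>
  Every point lies in some closed alcove.
\<close>

lemma regular_point_near:
  obtains x0 where "\<And>r. r \<in> R \<Longrightarrow> r \<bullet> x0 \<notin> \<int>" "\<And>r. r \<in> R \<Longrightarrow> r \<bullet> x \<le> \<lceil>r \<bullet> x0\<rceil>"
proof -
  obtain w where w: "\<And>r. r \<in> R \<Longrightarrow> r \<bullet> w \<noteq> 0"
    using generic_vector[OF finite_roots nonzero] by blast
  have lim: "((\<lambda>t. r \<bullet> (x + t *\<^sub>R w)) \<longlongrightarrow> r \<bullet> (x + 0 *\<^sub>R w)) (at_right 0)" for r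
    by (intro tendsto_intros)
  have "\<forall>\<^sub>F t in at_right 0. r \<bullet> (x + t *\<^sub>R w) \<notin> \<int> \<and> r \<bullet> x \<le> \<lceil>r \<bullet> (x + t *\<^sub>R w)\<rceil>" if r: "r \<in> R" for r
  proof -
    define f where "f = \<lfloor>r \<bullet> x\<rfloor>"
    have "\<forall>\<^sub>F t in at_right 0. r \<bullet> (x + t *\<^sub>R w) < f + 1"
      using lim by (rule order_tendstoD(2)) (simp add: f_def)
    moreover have "\<forall>\<^sub>F t in at_right 0. f - 1 < r \<bullet> (x + t *\<^sub>R w)"
      using lim by (rule order_tendstoD(1)) (simp add: f_def; linarith)
    moreover have "\<forall>\<^sub>F t in at_right 0. f < r \<bullet> (x + t *\<^sub>R w)" if "r \<bullet> x \<noteq> f"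
    proof (rule order_tendstoD(1)[OF lim])
      have "f \<le> r \<bullet> x"
        by (simp add: f_def)
      then show "f < r \<bullet> (x + 0 *\<^sub>R w)"
        using that by simp
    qed
    then have "\<forall>\<^sub>F t in at_right 0. r \<bullet> x \<noteq> f \<longrightarrow> f < r \<bullet> (x + t *\<^sub>R w)"
      by (cases "r \<bullet> x = f") auto
    moreover have "\<forall>\<^sub>F t::real in at_right 0. 0 < t"
      by (rule eventually_at_right_less)
    ultimately show ?thesis
    proof eventually_elim
      case (elim t)
      let ?y = "r \<bullet> (x + t *\<^sub>R w)"
      have ne: "?y \<noteq> r \<bullet> x"
        using elim(4) w[OF r] by (simp add: inner_add_right)
      have "?y \<notin> \<int>"
      proof
        assume "?y \<in> \<int>"
        then obtain k :: int where k: "?y = k"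
          by (metis Ints_cases)
        then have "k = f"
          using elim(1,2) by linarith
        then show False
          using elim(3) ne k by auto
      qed
      moreover have "r \<bullet> x \<le> \<lceil>?y\<rceil>"
      proof (cases "r \<bullet> x = f")
        case True
        have "f - 1 < ?y" using elim(2) .
        then have "f \<le> \<lceil>?y\<rceil>" by linarith
        then show ?thesis using True by simp
      next
        case False
        then have "f + 1 \<le> \<lceil>?y\<rceil>"
          using elim(3) by linarith
        moreover have "r \<bullet> x < f + 1"
          by (simp add: f_def)
        ultimately show ?thesis by linarith
      qed
      ultimately show ?case by blast
    qed
  qed
  then have "\<forall>\<^sub>F t in at_right 0. \<forall>r\<in>R. r \<bullet> (x + t *\<^sub>R w) \<notin> \<int> \<and> r \<bullet> x \<le> \<lceil>r \<bullet> (x + t *\<^sub>R w)\<rceil>"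
    using finite_roots by (simp add: eventually_ball_finite_distrib)
  then obtain t where "\<forall>r\<in>R. r \<bullet> (x + t *\<^sub>R w) \<notin> \<int> \<and> r \<bullet> x \<le> \<lceil>r \<bullet> (x + t *\<^sub>R w)\<rceil>"
    using eventually_happens'[OF trivial_limit_at_right_real] by blast
  then show ?thesis
    using that by blast
qed

lemma cell_simplex:
  obtains V where "finite V" "\<not> affine_dependent V"
    "{y. same_cell x y} = rel_interior (convex hull V)"
    "\<And>v. v \<in> V \<Longrightarrow> {y. same_cell v y} = {v}"
    "\<And>v r k. \<lbrakk>v \<in> V; r \<in> R; r \<bullet> x \<le> of_int k\<rbrakk> \<Longrightarrow> r \<bullet> v \<le> of_int k"
proof -
  obtain x0 where x0: "\<And>r. r \<in> R \<Longrightarrow> r \<bullet> x0 \<notin> \<int>" "\<And>r. r \<in> R \<Longrightarrow> r \<bullet> x \<le> \<lceil>r \<bullet> x0\<rceil>"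
    using regular_point_near by blast
  interpret alcove R x0
    by unfold_locales (rule x0(1))
  obtain S where S: "cuts S" "\<And>a. a \<in> S \<Longrightarrow> \<not> cuts (S - {a})"
    using minimal_cut_exists by blast
  interpret alcove_walls R x0 S
    by unfold_locales (use S in auto)
  have "x \<in> K"
    using x0(2) by (simp add: K_def level_def)
  then show ?thesis
    by (rule cell_is_open_simplex) (rule that)
qed

end

section \<open>The Euclidean Coxeter complex\<close>

lemma root_vectors_riesz:
  fixes \<Phi> :: "'a::euclidean_space dual set"
  assumes rs: "root_system \<Phi>" and ess: "essential \<Phi>" and irr: "irreducible_roots \<Phi>"
  shows "root_vectors (riesz ` \<Phi>)"
proof -
  have riesz_eqI: "riesz p = u" if "\<And>x. p x = u \<bullet> x" for p :: "'a dual" and u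
  proof -
    have "\<forall>x. riesz p \<bullet> x = u \<bullet> x"
      using that by (simp add: riesz_inner)
    then show ?thesis
      by (simp only: vector_eq_rdot)
  qed
  have linear: "linear (riesz :: 'a dual \<Rightarrow> 'a)"
    by (rule linearI; rule riesz_eqI)
      (simp_all add: blinfun.add_left blinfun.scaleR_left inner_add_left flip: riesz_inner)
  have inj: "inj (riesz :: 'a dual \<Rightarrow> 'a)"
    by (rule injI, rule blinfun_eqI) (simp add: riesz_inner)
  have coroot: "p (coroot q) = 2 * (riesz p \<bullet> riesz q) / (riesz q \<bullet> riesz q)" for p q :: "'a dual"
    by (simp add: coroot_def dual_inner_def riesz_inner[of p])
  have refl: "riesz (root_reflection q p)
      = riesz p - (2 * (riesz p \<bullet> riesz q) / (riesz q \<bullet> riesz q)) *\<^sub>R riesz q" for p q :: "'a dual"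
    by (simp add: root_reflection_def coroot linear_diff[OF linear] linear_scale[OF linear])
  have line: "range (\<lambda>c. c *\<^sub>R \<alpha>) \<inter> \<Phi> = {\<alpha>, - \<alpha>}" if "\<alpha> \<in> \<Phi>" for \<alpha>
    using rs that by (auto simp: root_system_def)
  have zero: "0 \<notin> \<Phi>"
    using rs by (simp add: root_system_def)
  show ?thesis
  proof
    show "finite (riesz ` \<Phi>)"
      using rs by (simp add: root_system_def)
    show "0 \<notin> riesz ` \<Phi>"
    proof
      assume "0 \<in> riesz ` \<Phi>"
      then obtain \<alpha> where "\<alpha> \<in> \<Phi>" "riesz \<alpha> = riesz 0"
        using linear_0[OF linear] by auto
      then show False
        using zero injD[OF inj] by blast
    qed
    show "- r \<in> riesz ` \<Phi>" if r: "r \<in> riesz ` \<Phi>" for r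
    proof -
      obtain \<alpha> where \<alpha>: "\<alpha> \<in> \<Phi>" "r = riesz \<alpha>"
        using r by blast
      then have "- \<alpha> \<in> \<Phi>"
        using line[OF \<alpha>(1)] by blast
      then show ?thesis
        unfolding \<alpha>(2) linear_neg[OF linear, of \<alpha>, symmetric] by (rule imageI)
    qed
    show "r - (2 * (r \<bullet> s) / (s \<bullet> s)) *\<^sub>R s \<in> riesz ` \<Phi>"
      if rsR: "r \<in> riesz ` \<Phi>" "s \<in> riesz ` \<Phi>" for r s
    proof -
      obtain \<alpha> \<beta> where "\<alpha> \<in> \<Phi>" "\<beta> \<in> \<Phi>" and rs': "r = riesz \<alpha>" "s = riesz \<beta>"
        using rsR by blast
      then have "root_reflection \<beta> \<alpha> \<in> \<Phi>"
        using rs by (simp add: root_system_def)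
      then show ?thesis
        unfolding rs' refl[symmetric] by (rule imageI)
    qed
    show "2 * (r \<bullet> s) / (s \<bullet> s) \<in> \<int>" if rsR: "r \<in> riesz ` \<Phi>" "s \<in> riesz ` \<Phi>" for r s
    proof -
      obtain \<alpha> \<beta> where "\<alpha> \<in> \<Phi>" "\<beta> \<in> \<Phi>" and rs': "r = riesz \<alpha>" "s = riesz \<beta>"
        using rsR by blast
      then have "\<alpha> (coroot \<beta>) \<in> \<int>"
        using rs by (simp add: root_system_def)
      then show ?thesis
        unfolding rs' coroot .
    qed
    show "c = 1 \<or> c = -1" if r: "r \<in> riesz ` \<Phi>" "c *\<^sub>R r \<in> riesz ` \<Phi>" for r c
    proof -
      obtain \<alpha> where \<alpha>: "\<alpha> \<in> \<Phi>" "r = riesz \<alpha>"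
        using r by blast
      then have "riesz (c *\<^sub>R \<alpha>) \<in> riesz ` \<Phi>"
        using r(2) by (simp add: linear_scale[OF linear])
      then have "c *\<^sub>R \<alpha> \<in> \<Phi>"
        using inj by (simp add: inj_image_mem_iff)
      then have "c *\<^sub>R \<alpha> = 1 *\<^sub>R \<alpha> \<or> c *\<^sub>R \<alpha> = (-1) *\<^sub>R \<alpha>"
        using line[OF \<alpha>(1)] by auto
      then show ?thesis
        using \<alpha>(1) zero scaleR_right_imp_eq[of \<alpha>] by blast
    qed
    show "span (riesz ` \<Phi>) = UNIV"
    proof -
      have "u \<in> range riesz" for u :: 'a
      proof -
        obtain p :: "'a dual" where "\<forall>x. p x = u \<bullet> x"
          using linear_functional_ex ..
        then have "riesz p = u"
          by (intro riesz_eqI) simp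
        then show ?thesis
          by (rule range_eqI[OF sym])
      qed
      then have "range riesz = (UNIV :: 'a set)"
        by blast
      then show ?thesis
        using ess by (simp add: essential_def linear_span_image[OF linear])
    qed
    show "A = {} \<or> B = {}"
      if AB: "A \<union> B = riesz ` \<Phi>" "A \<inter> B = {}" "\<And>a b. a \<in> A \<Longrightarrow> b \<in> B \<Longrightarrow> a \<bullet> b = 0" for A B
    proof (rule ccontr)
      assume ne: "\<not> ?thesis"
      let ?A = "\<Phi> \<inter> riesz -` A" and ?B = "\<Phi> \<inter> riesz -` B"
      have mem: "riesz \<alpha> \<in> A \<or> riesz \<alpha> \<in> B" if "\<alpha> \<in> \<Phi>" for \<alpha>
        using imageI[OF that, of riesz] by (simp flip: AB(1))
      have "A \<subseteq> riesz ` \<Phi>" "B \<subseteq> riesz ` \<Phi>"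
        unfolding AB(1)[symmetric] by simp_all
      then have "?A \<noteq> {}" "?B \<noteq> {}"
        using ne by auto
      moreover have "?A \<inter> ?B = {}" "?A \<union> ?B = \<Phi>"
        using mem AB(2) by auto
      moreover have "\<forall>\<alpha>\<in>?A. \<forall>\<beta>\<in>?B. dual_inner \<alpha> \<beta> = 0"
        using AB(3) by (simp add: dual_inner_def)
      ultimately have "\<not> irreducible_roots \<Phi>"
        unfolding irreducible_roots_def not_not by (intro exI[of _ ?A] exI[of _ ?B] conjI)
      then show False
        using irr by contradiction
    qed
  qed
qed

lemma same_cell_riesz:
  fixes \<Phi> :: "'a::euclidean_space dual set"
  assumes "root_vectors (riesz ` \<Phi>)"
  shows "root_vectors.same_cell (riesz ` \<Phi>) x y \<longleftrightarrow>
    (\<forall>\<alpha>\<in>\<Phi>. \<forall>k::int. (blinfun_apply \<alpha> y = k \<longleftrightarrow> blinfun_apply \<alpha> x = k) \<and> (blinfun_apply \<alpha> y < k \<longleftrightarrow> blinfun_apply \<alpha> x < k))"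
  by (simp add: root_vectors.same_cell_def[OF assms] riesz_inner)

lemma cells_eq:
  fixes \<Phi> :: "'a::euclidean_space dual set"
  assumes "root_vectors (riesz ` \<Phi>)"
  shows "C \<in> cells \<Phi> \<and> x \<in> C \<longleftrightarrow> C = {y. root_vectors.same_cell (riesz ` \<Phi>) x y}"
proof -
  define sg :: "'a \<Rightarrow> 'a dual \<Rightarrow> int \<Rightarrow> sign" where
    "sg x \<alpha> k = (if \<alpha> x = k then Zero else if \<alpha> x < k then Neg else Pos)" for x \<alpha> k
  have sign: "y \<in> half_or_hyperplane s \<alpha> k \<longleftrightarrow> sg y \<alpha> k = s" for y s \<alpha> k
    by (cases s) (auto simp: sg_def)
  have same: "root_vectors.same_cell (riesz ` \<Phi>) x y \<longleftrightarrow> (\<forall>\<alpha>\<in>\<Phi>. \<forall>k. sg y \<alpha> k = sg x \<alpha> k)" for x y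
  proof -
    have "sg y \<alpha> k = sg x \<alpha> k \<longleftrightarrow> (\<alpha> y = k \<longleftrightarrow> \<alpha> x = k) \<and> (\<alpha> y < k \<longleftrightarrow> \<alpha> x < k)" for \<alpha> :: "'a dual" and k
      by (auto simp: sg_def)
    then show ?thesis
      unfolding same_cell_riesz[OF assms] by blast
  qed
  have memI: "y \<in> (\<Inter>(\<alpha>, k) \<in> \<Phi> \<times> UNIV. half_or_hyperplane (\<sigma> \<alpha> k) \<alpha> k)
      \<longleftrightarrow> (\<forall>\<alpha>\<in>\<Phi>. \<forall>k. sg y \<alpha> k = \<sigma> \<alpha> k)" for y \<sigma>
    by (auto simp: sign)
  show ?thesis
  proof
    assume C: "C \<in> cells \<Phi> \<and> x \<in> C"
    then obtain \<sigma> where "C = (\<Inter>(\<alpha>, k) \<in> \<Phi> \<times> UNIV. half_or_hyperplane (\<sigma> \<alpha> k) \<alpha> k)"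
      by (auto simp: cells_def)
    then have mem: "y \<in> C \<longleftrightarrow> (\<forall>\<alpha>\<in>\<Phi>. \<forall>k. sg y \<alpha> k = \<sigma> \<alpha> k)" for y
      by (simp only: memI)
    then have "\<forall>\<alpha>\<in>\<Phi>. \<forall>k. sg x \<alpha> k = \<sigma> \<alpha> k"
      using C by blast
    then have "y \<in> C \<longleftrightarrow> root_vectors.same_cell (riesz ` \<Phi>) x y" for y
      unfolding mem same by simp
    then show "C = {y. root_vectors.same_cell (riesz ` \<Phi>) x y}"
      by blast
  next
    assume C: "C = {y. root_vectors.same_cell (riesz ` \<Phi>) x y}"
    have "C = (\<Inter>(\<alpha>, k) \<in> \<Phi> \<times> UNIV. half_or_hyperplane (sg x \<alpha> k) \<alpha> k)"
      unfolding C by (rule set_eqI) (simp only: memI mem_Collect_eq same)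
    moreover have "x \<in> C"
      using C same by simp
    ultimately show "C \<in> cells \<Phi> \<and> x \<in> C"
      unfolding cells_def by blast
  qed
qed

text \<open>
  The vertices are recovered from the open simplex as the extreme points of its closure.
\<close>

lemma cell_vertices_eqI:
  fixes V :: "'a::euclidean_space set"
  assumes V: "\<not> affine_dependent V" and A: "A = rel_interior (convex hull V)"
  shows "cell_vertices A = V"
proof -
  have vertices: "{x. x extreme_point_of closure A} = W"
    if W: "\<not> affine_dependent W" "A = rel_interior (convex hull W)" for W :: "'a set"
  proof -
    have "closure A = closure (convex hull W)"
      using W(2) by (simp add: convex_closure_rel_interior)
    also have "\<dots> = convex hull W"
      using aff_independent_finite[OF W(1)]
      by (simp add: finite_imp_compact_convex_hull compact_imp_closed)
    finally show ?thesis
      using extreme_point_of_convex_hull_affine_independent[OF W(1)] by auto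
  qed
  show ?thesis
    unfolding cell_vertices_def
  proof (rule the_equality)
    show "W = V" if "\<not> affine_dependent W \<and> A = rel_interior (convex hull W)" for W
      using vertices[of W] vertices[OF V A] that by simp
  qed (use V A in simp)
qed

lemma bary_coeffs_props:
  fixes V :: "'a::euclidean_space set"
  assumes V: "\<not> affine_dependent V" and cv: "cell_vertices (cell_of \<Phi> x) = V"
    and x: "x \<in> rel_interior (convex hull V)"
  shows "(\<forall>v\<in>V. bary_coeffs \<Phi> x v > 0)" "sum (bary_coeffs \<Phi> x) V = 1"
    "(\<Sum>v\<in>V. bary_coeffs \<Phi> x v *\<^sub>R v) = x"
proof -
  let ?P = "\<lambda>c. {v. c v \<noteq> 0} = V \<and> (\<forall>v. c v \<ge> 0) \<and> sum c V = 1 \<and> (\<Sum>v\<in>V. c v *\<^sub>R v) = x"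
  have fin: "finite V"
    using aff_independent_finite[OF V] .
  obtain u where u: "\<forall>v\<in>V. 0 < u v" "sum u V = 1" "(\<Sum>v\<in>V. u v *\<^sub>R v) = x"
    using x by (auto simp: rel_interior_convex_hull_explicit[OF V])
  have ex: "?P (\<lambda>v. if v \<in> V then u v else 0)"
    using u by (auto simp: less_imp_le cong: sum.cong)
  have unique: "c = d" if c: "?P c" and d: "?P d" for c d
  proof
    fix v
    have "(\<Sum>v\<in>V. c v - d v) = 0" "(\<Sum>v\<in>V. (c v - d v) *\<^sub>R v) = 0"
      using c d by (simp_all add: sum_subtractf scaleR_diff_left)
    then have "affine_dependent V" if "\<exists>v\<in>V. c v - d v \<noteq> 0"
      using that unfolding affine_dependent_explicit_finite[OF fin]
      by (intro exI[of _ "\<lambda>v. c v - d v"]) simp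
    then have "\<forall>v\<in>V. c v - d v = 0"
      using V by blast
    then show "c v = d v"
      using c d by (cases "v \<in> V") (simp, force)
  qed
  have "\<exists>!c. ?P c"
    by (rule ex1I, rule ex, rule unique[OF _ ex])
  from theI'[OF this] have "?P (bary_coeffs \<Phi> x)"
    unfolding bary_coeffs_def cv .
  then show "sum (bary_coeffs \<Phi> x) V = 1" "(\<Sum>v\<in>V. bary_coeffs \<Phi> x v *\<^sub>R v) = x"
    and "\<forall>v\<in>V. bary_coeffs \<Phi> x v > 0"
    by (simp_all add: order_less_le) blast
qed

text \<open>
  The facts about the Euclidean Coxeter complex that the argument uses: barycentric coordinates
  exist at every point, and the vertices of the cell of \<open>x\<close> lie in every integral L-convex
  polyhedron that contains \<open>x\<close>.
\<close>

lemma coxeter_cell: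
  fixes \<Phi> :: "'a::euclidean_space dual set"
  assumes "root_system \<Phi>" "essential \<Phi>" "irreducible_roots \<Phi>"
  obtains V where "V = cell_vertices (cell_of \<Phi> x)" "finite V" "V \<subseteq> vertices \<Phi>"
    "\<And>v. v \<in> V \<Longrightarrow> bary_coeffs \<Phi> x v > 0" "sum (bary_coeffs \<Phi> x) V = 1"
    "(\<Sum>v\<in>V. bary_coeffs \<Phi> x v *\<^sub>R v) = x"
    "\<And>v \<alpha> k. \<lbrakk>v \<in> V; \<alpha> \<in> \<Phi>; blinfun_apply \<alpha> x \<le> of_int k\<rbrakk> \<Longrightarrow> blinfun_apply \<alpha> v \<le> of_int k"
proof -
  interpret root_vectors "riesz ` \<Phi>"
    using root_vectors_riesz[OF assms] .
  note ce = cells_eq[OF root_vectors_axioms]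
  obtain V where V: "finite V" "\<not> affine_dependent V"
    "{y. same_cell x y} = rel_interior (convex hull V)"
    "\<And>v. v \<in> V \<Longrightarrow> {y. same_cell v y} = {v}"
    "\<And>v r k. \<lbrakk>v \<in> V; r \<in> riesz ` \<Phi>; r \<bullet> x \<le> of_int k\<rbrakk> \<Longrightarrow> r \<bullet> v \<le> of_int k"
    by (rule cell_simplex[of x]) (rule that)
  have "cell_of \<Phi> x = {y. same_cell x y}"
    unfolding cell_of_def ce by simp
  then have co: "cell_of \<Phi> x = rel_interior (convex hull V)"
    using V(3) by simp
  have cv: "cell_vertices (cell_of \<Phi> x) = V"
    by (rule cell_vertices_eqI[OF V(2) co])
  have xin: "x \<in> rel_interior (convex hull V)"
    unfolding V(3)[symmetric] by (simp add: same_cell_def)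
  have sub: "V \<subseteq> vertices \<Phi>"
  proof
    fix v assume "v \<in> V"
    then have "{v} \<in> cells \<Phi> \<and> v \<in> {v}"
      unfolding ce using V(4) by simp
    then show "v \<in> vertices \<Phi>"
      by (simp add: vertices_def)
  qed
  have le: "\<alpha> v \<le> of_int k" if "v \<in> V" "\<alpha> \<in> \<Phi>" "\<alpha> x \<le> of_int k" for v k and \<alpha> :: "'a dual"
    using V(5)[of v "riesz \<alpha>" k] that by (simp add: riesz_inner)
  note props = bary_coeffs_props[OF V(2) cv xin]
  show ?thesis
    by (rule that[of V]) (use cv V(1) sub props le in simp_all)
qed

section \<open>Lovasz extension and convex hulls\<close>

text \<open>
  At a point \<open>x\<close> of the domain of \<open>h\<close>, a subgradient gives a face of \<open>h\<close> through \<open>x\<close>. Being an integral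
  L-convex polyhedron it contains the vertices of the cell of \<open>x\<close>, and \<open>h\<close> is affine on it. Outside
  the domain, convexity forces the value \<open>\<infinity>\<close> at some vertex of the cell.
\<close>

lemma L_convex_eq_lovasz:
  fixes \<Phi> :: "'a::euclidean_space dual set"
  assumes rs: "root_system \<Phi>" "essential \<Phi>" "irreducible_roots \<Phi>"
    and h: "primal_integral_L_convex \<Phi> h" and hf: "\<And>v. v \<in> vertices \<Phi> \<Longrightarrow> f v = h v"
  shows "lovasz \<Phi> f = h"
proof
  fix x
  have prp: "proper_fun h" and lp: "locally_polyhedral_fun h"
    and faces: "\<And>P. P \<in> min_faces h \<Longrightarrow> integral_L_polyhedron \<Phi> P"
    using h by (auto simp: primal_integral_L_convex_def)
  obtain V where V: "V = cell_vertices (cell_of \<Phi> x)" "finite V" "V \<subseteq> vertices \<Phi>"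
    "\<And>v. v \<in> V \<Longrightarrow> bary_coeffs \<Phi> x v > 0" "sum (bary_coeffs \<Phi> x) V = 1"
    "(\<Sum>v\<in>V. bary_coeffs \<Phi> x v *\<^sub>R v) = x"
    "\<And>v \<alpha> k. \<lbrakk>v \<in> V; \<alpha> \<in> \<Phi>; blinfun_apply \<alpha> x \<le> of_int k\<rbrakk> \<Longrightarrow> blinfun_apply \<alpha> v \<le> of_int k"
    by (rule coxeter_cell[OF rs, of x]) (rule that)
  let ?c = "bary_coeffs \<Phi> x"
  have lov: "lovasz \<Phi> f x = (\<Sum>v\<in>V. ereal (?c v) * h v)"
    unfolding lovasz_def V(1)[symmetric] using V(3) hf by (intro sum.cong) auto
  show "lovasz \<Phi> f x = h x"
  proof (cases "h x = \<infinity>")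
    case False
    obtain p :: "'a dual" where p: "x \<in> argmin_set (\<lambda>y. h y - ereal (p y))"
      using subgradient_exists[OF prp lp False] by blast
    let ?P = "argmin_set (\<lambda>y. h y - ereal (p y))"
    have "?P \<in> min_faces h"
      using p unfolding min_faces_def by blast
    then obtain \<gamma> :: "'a dual \<Rightarrow> ereal"
      where \<gamma>: "\<And>\<alpha>. \<alpha> \<in> \<Phi> \<Longrightarrow> \<gamma> \<alpha> = \<infinity> \<or> (\<exists>k::int. \<gamma> \<alpha> = ereal (of_int k))"
        and P: "?P = {x. \<forall>\<alpha>\<in>\<Phi>. ereal (blinfun_apply \<alpha> x) \<le> \<gamma> \<alpha>}"
      using faces unfolding integral_L_polyhedron_def by blast
    obtain m where m: "h x = ereal m"
      using real_of_proper[OF prp False] by metis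
    have hv: "h v = ereal (m - p x + p v)" if v: "v \<in> V" for v
    proof -
      have "ereal (\<alpha> v) \<le> \<gamma> \<alpha>" if \<alpha>: "\<alpha> \<in> \<Phi>" for \<alpha> :: "'a dual"
        using \<gamma>[OF \<alpha>] V(7)[OF v \<alpha>] p \<alpha> unfolding P by auto
      then have "v \<in> ?P"
        unfolding P by blast
      then have "h v - ereal (p v) = h x - ereal (p x)"
        using p by (intro antisym) (auto simp: argmin_set_def)
      then show ?thesis
        by (cases "h v") (auto simp: m)
    qed
    have "lovasz \<Phi> f x = (\<Sum>v\<in>V. ereal (?c v * (m - p x + p v)))"
      unfolding lov using hv by (intro sum.cong) auto
    also have "\<dots> = ereal (\<Sum>v\<in>V. ?c v * (m - p x + p v))"
      by simp
    also have "(\<Sum>v\<in>V. ?c v * (m - p x + p v)) = (m - p x) * sum ?c V + p (\<Sum>v\<in>V. ?c v *\<^sub>R v)"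
      by (simp add: blinfun.sum_right blinfun.scaleR_right distrib_left sum.distrib sum_distrib_left mult.commute)
    also have "\<dots> = m"
      by (simp add: V(5,6))
    finally show ?thesis
      by (simp add: m)
  next
    case True
    have "\<exists>v\<in>V. h v = \<infinity>"
    proof (rule ccontr)
      assume "\<not> ?thesis"
      then have "\<And>v. v \<in> V \<Longrightarrow> ereal (real_of_ereal (h v)) = h v"
        using real_of_proper[OF prp] by blast
      then have "(v, real_of_ereal (h v)) \<in> epi h" if "v \<in> V" for v
        using that by (simp add: epi_def)
      then have "(\<Sum>v\<in>V. ?c v *\<^sub>R (v, real_of_ereal (h v))) \<in> epi h"
        using V(2,4,5) lp unfolding locally_polyhedral_fun_def locally_polyhedral_def
        by (intro convex_sum) (auto intro: less_imp_le)
      moreover have "(\<Sum>v\<in>V. ?c v *\<^sub>R (v, real_of_ereal (h v))) = (x, \<Sum>v\<in>V. ?c v * real_of_ereal (h v))"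
        using V(6) by (simp add: prod_eq_iff fst_sum snd_sum)
      ultimately show False
        using True by (simp add: epi_def)
    qed
    then obtain v where v: "v \<in> V" "h v = \<infinity>" by blast
    have "(\<Sum>v\<in>V. ereal (?c v) * h v) = \<infinity>"
      using v V(4)[OF v(1)] V(2) by (subst sum_Pinfty) (auto intro!: bexI[of _ v])
    then show ?thesis
      using lov True by simp
  qed
qed

lemma conv_fun_eq:
  fixes \<Phi> :: "'a::euclidean_space dual set"
  assumes rs: "root_system \<Phi>" "essential \<Phi>" "irreducible_roots \<Phi>"
    and f: "vertex_function \<Phi> f"
    and h: "primal_integral_L_convex \<Phi> h" and hf: "\<And>v. v \<in> vertices \<Phi> \<Longrightarrow> f v = h v"
  shows "conv_fun f = h" and "closed_conv_fun f = h"
proof -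
  have prp: "proper_fun h" and lp: "locally_polyhedral_fun h"
    using h by (auto simp: primal_integral_L_convex_def)
  have lov: "lovasz \<Phi> f = h"
    by (rule L_convex_eq_lovasz[OF rs h hf])
  have dom: "y \<in> vertices \<Phi> \<and> f y = h y \<and> ereal (real_of_ereal (h y)) = h y" if "y \<in> fdom f" for y
  proof -
    have y: "y \<in> vertices \<Phi>"
      using that f by (force simp: fdom_def vertex_function_def)
    then show ?thesis
      using that hf[OF y] by (auto simp: fdom_def ereal_real)
  qed
  \<comment> \<open>At a point of its domain, \<open>h\<close> is a convex combination of values of \<open>f\<close>.\<close>
  have comb: "\<exists>V c. finite V \<and> V \<subseteq> fdom f \<and> (\<forall>y\<in>V. c y \<ge> 0) \<and> sum c V = 1 \<and>
      (\<Sum>y\<in>V. c y *\<^sub>R y) = x \<and> (\<Sum>y\<in>V. ereal (c y) * f y) = h x" if x: "h x \<noteq> \<infinity>" for x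
  proof -
    obtain V where V: "V = cell_vertices (cell_of \<Phi> x)" "finite V" "V \<subseteq> vertices \<Phi>"
      "\<And>v. v \<in> V \<Longrightarrow> bary_coeffs \<Phi> x v > 0" "sum (bary_coeffs \<Phi> x) V = 1"
      "(\<Sum>v\<in>V. bary_coeffs \<Phi> x v *\<^sub>R v) = x"
      "\<And>v \<alpha> k. \<lbrakk>v \<in> V; \<alpha> \<in> \<Phi>; blinfun_apply \<alpha> x \<le> of_int k\<rbrakk> \<Longrightarrow> blinfun_apply \<alpha> v \<le> of_int k"
      by (rule coxeter_cell[OF rs, of x]) (rule that)
    let ?c = "bary_coeffs \<Phi> x"
    have s: "(\<Sum>y\<in>V. ereal (?c y) * f y) = h x"
      using fun_cong[OF lov, of x] unfolding lovasz_def V(1)[symmetric] .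
    have "v \<in> fdom f" if v: "v \<in> V" for v
    proof -
      have "f v \<noteq> \<infinity>"
      proof
        assume "f v = \<infinity>"
        then have "(\<Sum>y\<in>V. ereal (?c y) * f y) = \<infinity>"
          using v V(4)[OF v] V(2) by (subst sum_Pinfty) (auto intro!: bexI[of _ v])
        then show False
          using s x by simp
      qed
      moreover have "f v \<noteq> - \<infinity>"
        using f V(3) v by (auto simp: vertex_function_def)
      ultimately show ?thesis
        by (auto simp: fdom_def)
    qed
    then show ?thesis
      using V(2,4,5,6) s by (intro exI[of _ V] exI[of _ ?c]) (auto intro: less_imp_le)
  qed
  have jensen: "h x \<le> (\<Sum>y\<in>S. ereal (c y) * f y)"
    if S: "finite S" "S \<subseteq> fdom f" "\<forall>y\<in>S. c y \<ge> 0" "sum c S = 1" "(\<Sum>y\<in>S. c y *\<^sub>R y) = x" for S c x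
  proof -
    have "(y, real_of_ereal (h y)) \<in> epi h" if "y \<in> S" for y
      using dom S(2) that by (auto simp: epi_def)
    then have "(\<Sum>y\<in>S. c y *\<^sub>R (y, real_of_ereal (h y))) \<in> epi h"
      using S lp unfolding locally_polyhedral_fun_def locally_polyhedral_def
      by (intro convex_sum) auto
    moreover have "(\<Sum>y\<in>S. c y *\<^sub>R (y, real_of_ereal (h y))) = (x, \<Sum>y\<in>S. c y * real_of_ereal (h y))"
      using S(5) by (simp add: prod_eq_iff fst_sum snd_sum)
    ultimately have "h x \<le> ereal (\<Sum>y\<in>S. c y * real_of_ereal (h y))"
      by (simp add: epi_def)
    also have "\<dots> = (\<Sum>y\<in>S. ereal (c y * real_of_ereal (h y)))"
      by simp
    also have "\<dots> = (\<Sum>y\<in>S. ereal (c y) * f y)"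
    proof (rule sum.cong[OF refl])
      fix y assume "y \<in> S"
      then have "f y = ereal (real_of_ereal (h y))"
        using dom[of y] S(2) by auto
      then show "ereal (c y * real_of_ereal (h y)) = ereal (c y) * f y"
        by simp
    qed
    finally show ?thesis .
  qed
  show "conv_fun f = h"
  proof
    fix x
    show "conv_fun f x = h x"
    proof (rule antisym)
      show "conv_fun f x \<le> h x"
      proof (cases "h x = \<infinity>")
        case False
        from comb[OF this] obtain V c where V: "finite V" "V \<subseteq> fdom f" "\<forall>y\<in>V. c y \<ge> 0" "sum c V = 1"
          "(\<Sum>y\<in>V. c y *\<^sub>R y) = x" "(\<Sum>y\<in>V. ereal (c y) * f y) = h x"
          by (elim exE conjE) (rule that)
        show ?thesis
          unfolding conv_fun_def V(6)[symmetric] by (rule Inf_lower) (use V in blast)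
      qed simp
      show "h x \<le> conv_fun f x"
        unfolding conv_fun_def by (rule Inf_greatest) (use jensen in blast)
    qed
  qed
  show "closed_conv_fun f = h"
  proof
    fix x
    show "closed_conv_fun f x = h x"
    proof (rule antisym)
      have "ereal (p x - r) \<le> h x" if p: "\<forall>y\<in>fdom f. ereal (p y - r) \<le> f y" for p :: "'a dual" and r
      proof (cases "h x = \<infinity>")
        case False
        from comb[OF this] obtain V c where V: "finite V" "V \<subseteq> fdom f" "\<forall>y\<in>V. c y \<ge> 0" "sum c V = 1"
          "(\<Sum>y\<in>V. c y *\<^sub>R y) = x" "(\<Sum>y\<in>V. ereal (c y) * f y) = h x"
          by (elim exE conjE) (rule that)
        have "p x - r = p (\<Sum>y\<in>V. c y *\<^sub>R y) - r * sum c V"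
          by (simp add: V(4,5))
        also have "\<dots> = (\<Sum>y\<in>V. c y * (p y - r))"
          by (simp add: blinfun.sum_right blinfun.scaleR_right right_diff_distrib sum_subtractf
              sum_distrib_left mult.commute)
        finally have "ereal (p x - r) = (\<Sum>y\<in>V. ereal (c y) * ereal (p y - r))"
          by simp
        also have "\<dots> \<le> (\<Sum>y\<in>V. ereal (c y) * f y)"
          using V(2,3) p by (intro sum_mono ereal_mult_left_mono) auto
        finally show ?thesis
          using V(6) by simp
      qed simp
      then show "closed_conv_fun f x \<le> h x"
        unfolding closed_conv_fun_def by (intro Sup_least) blast
    next
      have minorant: "ereal (p x - r) \<le> closed_conv_fun f x"
        if "\<And>y. ereal (p y - r) \<le> h y" for p :: "'a dual" and r
      proof -
        have "\<forall>y\<in>fdom f. ereal (p y - r) \<le> f y"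
          using dom that by metis
        then show ?thesis
          unfolding closed_conv_fun_def by (intro Sup_upper) blast
      qed
      show "h x \<le> closed_conv_fun f x"
      proof (cases "h x = \<infinity>")
        case True
        have "ereal M \<le> closed_conv_fun f x" for M
        proof -
          obtain p :: "'a dual" and r where "\<And>y. ereal (p y - r) \<le> h y" "M < p x - r"
            using affine_minorant_above[OF prp lp True] by blast
          then show ?thesis
            using minorant[of p r] by (meson ereal_less_eq(3) less_imp_le order_trans)
        qed
        then have "closed_conv_fun f x = \<infinity>"
          by (rule ereal_top)
        then show ?thesis
          by simp
      next
        case False
        obtain p :: "'a dual" where p: "x \<in> argmin_set (\<lambda>y. h y - ereal (p y))"
          using subgradient_exists[OF prp lp False] by blast
        obtain m where m: "h x = ereal m"
          using real_of_proper[OF prp False] by metis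
        have "ereal (p y - (p x - m)) \<le> h y" for y
        proof -
          have "h x - ereal (p x) \<le> h y - ereal (p y)"
            using p by (simp add: argmin_set_def)
          then show ?thesis
            by (cases "h y") (auto simp: m)
        qed
        from minorant[OF this] show ?thesis
          by (simp add: m)
      qed
    qed
  qed
qed

theorem proposition6p2:
  fixes \<Phi> :: "'a::euclidean_space dual set" and f :: "'a \<Rightarrow> ereal"
  assumes "root_system \<Phi>" and "essential \<Phi>" and "irreducible_roots \<Phi>" and "classical_type \<Phi>"
    and "L_convex \<Phi> f"
  shows "lovasz \<Phi> f = conv_fun f \<and> conv_fun f = closed_conv_fun f \<and>
    primal_integral_L_convex \<Phi> (lovasz \<Phi> f) \<and>
    (\<forall>v\<in>vertices \<Phi>. lovasz \<Phi> f v = f v) \<and>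
    (\<forall>h. primal_integral_L_convex \<Phi> h \<and> (\<forall>v\<in>vertices \<Phi>. h v = f v) \<longrightarrow> h = lovasz \<Phi> f)"
proof -
  note rs = assms(1-3)
  obtain h where f: "vertex_function \<Phi> f" and h: "primal_integral_L_convex \<Phi> h"
    and hf: "\<And>v. v \<in> vertices \<Phi> \<Longrightarrow> f v = h v"
    using assms(5) unfolding L_convex_def by blast
  have lov: "lovasz \<Phi> f = h"
    by (rule L_convex_eq_lovasz[OF rs h hf])
  have "g = lovasz \<Phi> f"
    if "primal_integral_L_convex \<Phi> g" "\<forall>v\<in>vertices \<Phi>. g v = f v" for g
    using L_convex_eq_lovasz[OF rs that(1), of f] that(2) by simp
  then show ?thesis
    using lov h hf conv_fun_eq[OF rs f h hf] by simp
qed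

end
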